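(* Let $0<\delta\le1$, $0<\epsilon<\tfrac18$, $\kappa>0$ and $N\ge2$, and let $q\in\mathbf{N}$ with $N\ge q^{\kappa}$. Then there is $c_0>0$ such that \[ \sum_{\substack{x<n\le x+y\\ n\equiv r\ (\mathrm{mod}\ q)}}\tau_N(n)\ll\frac{y\,\phi(q)\log N}{q^2} \] uniformly for $N$, $r\in\mathbf{Z}$ with $(r,q)=1$, and real $x,y$ with $x^{\frac{1+4\epsilon\delta}{1+\delta}}\le y\le x$ and $x\ge c_0q^{1+\delta}$, where $c_0$ and the implied constant depend at most on $\delta,\epsilon,\kappa$. In particular, under the same conditions, \[ \sum_{\substack{m\le x\\ m\equiv r\ (\mathrm{mod}\ q)}}\tau_N(m)\ll\frac{\phi(q)\,x\log N}{q^2}. \]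
   Context: $\tau_N(m)=\#\{d\in\mathbf{N}: d\le N,\ d\mid m\}$ for $m\in\mathbf{N}$; sums are over positive integers. $\phi$ is Euler's totient function. *)

theory Defs
  imports Complex_Main "HOL-Number_Theory.Number_Theory"
begin

definition tau_le :: "real \<Rightarrow> nat \<Rightarrow> nat" where
  "tau_le N m = card {d :: nat. d > 0 \<and> real d \<le> N \<and> d dvd m}"

end

theory Submission
  imports Defs "HOL-Library.FuncSet"
begin

text \<open>
  For \<open>d\<close> up to \<open>z = x powr (\<eta>/2)\<close>, where \<open>z\<^sup>2 \<le> y / q\<close>, multiples of \<open>d\<close> in the progression can be counted
  directly, which settles \<open>N \<le> z\<close>: the sum \<open>\<Sum>d\<le>N. 1 / d\<close> over \<open>d\<close> coprime to \<open>q\<close> is \<open>O(\<phi>(q) / q * ln N)\<close>, because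
  multiplying it by the sum of \<open>1 / e\<close> over squarefree \<open>e\<close> dividing \<open>q\<close> gives at most \<open>\<Sum>n\<le>Nq. 1 / n\<close>.

  For \<open>N > z\<close> the full divisor function is compared with \<open>\<tau>\<^sub>z\<close>, following Erdos. Let \<open>a\<close> be the product of the
  smallest prime factors of \<open>n\<close>, taken as long as it stays at most \<open>z\<close>, let \<open>P\<close> be the next prime factor and
  \<open>b = n / a\<close>. Then \<open>\<tau>(n) \<le> \<tau>(a) \<tau>(b)\<close> with \<open>\<tau>(a) \<le> \<tau>\<^sub>z(n)\<close>, and \<open>\<tau>(b)\<close> is bounded unless \<open>P\<close> is much smaller
  than \<open>z\<close>. In that case \<open>a > z / P\<close> is a large \<open>P\<close>-smooth divisor of \<open>n\<close>. Sorting \<open>P\<close> into the ranges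
  from \<open>2 ^ 2 ^ i\<close> to \<open>2 ^ 2 ^ (i + 1)\<close>, a Rankin factor \<open>(a / sqrt z) powr \<beta>\<close> with \<open>\<beta> = min (1/4) (4 K / 2 ^ i)\<close>
  outweighs \<open>\<tau>(b)\<close> and leaves a saving that is summable over \<open>i\<close>.
\<close>

section \<open>Divisor counts\<close>

definition divisor_count :: "nat \<Rightarrow> nat" where
  "divisor_count n = card {d. d dvd n}"

lemma divisor_count_1 [simp]: "divisor_count (Suc 0) = 1"
  by (simp add: divisor_count_def)

text \<open>Every divisor of a product is a product of divisors. Factors with a common prime have to
  be covered, because in the later split \<open>n = a * b\<close> both parts may contain the prime
  \<open>P\<close>.\<close>

lemma divisor_count_mult_le:
  assumes "m > 0" "n > 0"
  shows "divisor_count (m * n) \<le> divisor_count m * divisor_count n"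
proof -
  have "{d. d dvd m * n} \<subseteq> (\<lambda>(a, b). a * b) ` ({d. d dvd m} \<times> {d. d dvd n})"
    by (auto elim!: dvd_productE)
  then have "card {d. d dvd m * n} \<le> card ({d. d dvd m} \<times> {d. d dvd n})"
    using assms by (intro surj_card_le) auto
  then show ?thesis
    by (simp add: divisor_count_def card_cartesian_product)
qed

lemma divisor_count_prod_le:
  assumes "finite A" "\<And>i. i \<in> A \<Longrightarrow> f i > 0"
  shows "divisor_count (\<Prod>i\<in>A. f i) \<le> (\<Prod>i\<in>A. divisor_count (f i))"
  using assms
proof (induction A rule: finite_induct)
  case (insert i A)
  have "divisor_count (f i * prod f A) \<le> divisor_count (f i) * divisor_count (prod f A)"
    using insert by (intro divisor_count_mult_le) (auto intro: prod_pos)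
  also have "\<dots> \<le> divisor_count (f i) * (\<Prod>i\<in>A. divisor_count (f i))"
    using insert by (intro mult_left_mono) auto
  finally show ?case using insert by simp
qed auto

lemma divisor_count_prime_power_le:
  assumes "prime p"
  shows "divisor_count (p ^ k) \<le> k + 1"
proof -
  have "{d. d dvd p ^ k} \<subseteq> (\<lambda>i. p ^ i) ` {..k}"
    using divides_primepow_nat[OF assms] by auto
  from surj_card_le[OF _ this] show ?thesis
    by (simp add: divisor_count_def)
qed

lemma divisor_count_prod_prime_powers_le:
  assumes "finite A" "\<And>p. p \<in> A \<Longrightarrow> prime p"
  shows "divisor_count (\<Prod>p\<in>A. p ^ f p) \<le> (\<Prod>p\<in>A. f p + 1)"
proof -
  have "divisor_count (\<Prod>p\<in>A. p ^ f p) \<le> (\<Prod>p\<in>A. divisor_count (p ^ f p))"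
    using assms by (intro divisor_count_prod_le) (auto simp: prime_gt_0_nat)
  also have "\<dots> \<le> (\<Prod>p\<in>A. f p + 1)"
    using assms divisor_count_prime_power_le by (intro prod_mono) auto
  finally show ?thesis .
qed

text \<open>Comparing \<open>exp\<close> with its tangent at 0, together with
  \<open>ln 2 \<ge> 1/2\<close>, costs the factor \<open>2 / \<xi>\<close>. This loss will occur
  only at the finitely many primes below \<open>2 powr (1 / \<xi>)\<close>.\<close>

lemma Suc_le_powr_bound:
  assumes "0 < \<xi>" "\<xi> \<le> 1"
  shows "real k + 1 \<le> 2 / \<xi> * 2 powr (real k * \<xi>)"
proof -
  have ln2: "ln 2 \<ge> (1/2 :: real)"
    using ln_le_minus_one[of "1/2 :: real"] by (simp add: ln_div)
  have "1 + real k * \<xi> * ln 2 \<le> exp (real k * \<xi> * ln 2)"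
    by (rule exp_ge_add_one_self)
  also have "\<dots> = 2 powr (real k * \<xi>)"
    by (simp add: powr_def)
  finally have 1: "1 + real k * \<xi> * ln 2 \<le> 2 powr (real k * \<xi>)" .
  have "real k * \<xi> * (1/2) \<le> real k * \<xi> * ln 2"
    using ln2 assms by (intro mult_left_mono) auto
  with 1 assms have "\<xi> / 2 + real k * \<xi> / 2 \<le> 2 powr (real k * \<xi>)"
    by linarith
  then have "2 / \<xi> * (\<xi> / 2 + real k * \<xi> / 2) \<le> 2 / \<xi> * 2 powr (real k * \<xi>)"
    using assms by (intro mult_left_mono) auto
  also have "2 / \<xi> * (\<xi> / 2 + real k * \<xi> / 2) = real k + 1"
    using assms by (simp add: field_simps)
  finally show ?thesis .
qed

text \<open>Here \<open>p powr (1 / 2 ^ i)\<close> is at least 2 and \<open>2 ^ k\<close> dominates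
  \<open>k + 1\<close>, so there is no constant that could accumulate over the primes.\<close>

lemma Suc_le_powr_half_power:
  assumes "2 ^ (2 ^ i) \<le> p"
  shows "real k + 1 \<le> real p powr (real k * (1 / 2 ^ i))"
proof -
  have "(2 :: real) ^ (2 ^ i) \<le> real p"
    using assms by (metis of_nat_le_iff of_nat_numeral of_nat_power)
  then have "((2 :: real) ^ (2 ^ i)) powr (real k * (1 / 2 ^ i)) \<le> real p powr (real k * (1 / 2 ^ i))"
    by (intro powr_mono2) auto
  moreover have "((2 :: real) ^ (2 ^ i)) powr (real k * (1 / 2 ^ i)) = 2 ^ k"
    by (simp add: powr_powr flip: powr_realpow)
  moreover have "real k + 1 \<le> 2 ^ k"
    using less_exp[of k] by (metis Suc_eq_plus1 Suc_leI of_nat_1 of_nat_add of_nat_le_iff of_nat_numeral of_nat_power)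
  ultimately show ?thesis by linarith
qed

text \<open>Local bounds are multiplied over the primes of \<open>b\<close>. The exponent
  \<open>1 / 2 ^ i\<close> comes without a constant by roughness; where it exceeds
  \<open>\<xi>\<close>, the smaller exponent \<open>\<xi>\<close> costs a factor \<open>D\<close> at
  each prime below \<open>W\<close>. Hence \<open>D ^ W\<close> works for all \<open>i\<close> and
  \<open>b\<close>.\<close>

lemma divisor_count_rough_bound:
  assumes "0 < \<xi>" "\<xi> \<le> 1"
  shows "\<exists>C \<ge> 1. \<forall>i b. b > 0 \<and> (\<forall>p \<in> prime_factors b. 2 ^ (2 ^ i) \<le> p) \<longrightarrow>
           real (divisor_count b) \<le> C * real b powr (min \<xi> (1 / 2 ^ i))"
proof -
  \<comment> \<open>From \<open>W\<close> on, \<open>p powr \<xi>\<close> is at least 2, so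
    \<open>k + 1 \<le> 2 ^ k\<close> applies and no constant is lost.\<close>
  define W where "W = nat \<lceil>2 powr (1 / \<xi>)\<rceil>"
  define D where "D = 2 / \<xi>"
  have D: "D \<ge> 1" using assms by (simp add: D_def field_simps)
  have "real (divisor_count b) \<le> D ^ W * real b powr (min \<xi> (1 / 2 ^ i))"
    if b: "b > 0" and rough: "\<forall>p \<in> prime_factors b. 2 ^ (2 ^ i) \<le> p" for b i
  proof -
    define \<theta> where "\<theta> = min \<xi> (1 / 2 ^ i)"
    define c where "c = (\<lambda>p. if p < W then D else 1)"
    let ?P = "prime_factors b"
    have \<theta>: "\<theta> > 0" using assms by (simp add: \<theta>_def)
    have local: "real (multiplicity p b) + 1 \<le> c p * real p powr (real (multiplicity p b) * \<theta>)"
      if p: "p \<in> ?P" for p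
    proof (cases "1 / 2 ^ i \<le> \<xi>")
      case True
      then have "\<theta> = 1 / 2 ^ i" by (simp add: \<theta>_def min_def)
      with Suc_le_powr_half_power[of i p "multiplicity p b"] rough p
      have le: "real (multiplicity p b) + 1 \<le> real p powr (real (multiplicity p b) * \<theta>)"
        by simp
      also have "\<dots> \<le> c p * real p powr (real (multiplicity p b) * \<theta>)"
        using D by (simp add: c_def mult_le_cancel_right1)
      finally show ?thesis .
    next
      case False
      then have \<theta>_eq: "\<theta> = \<xi>" by (simp add: \<theta>_def)
      show ?thesis
      proof (cases "p < W")
        case True
        have "real (multiplicity p b) + 1 \<le> D * 2 powr (real (multiplicity p b) * \<xi>)"
          unfolding D_def by (rule Suc_le_powr_bound) fact+
        also have "\<dots> \<le> D * real p powr (real (multiplicity p b) * \<xi>)"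
          using D p assms prime_ge_2_nat[of p] by (intro mult_left_mono powr_mono2) auto
        finally show ?thesis using True by (simp add: c_def \<theta>_eq)
      next
        case False
        then have "2 powr (1 / \<xi>) \<le> real p"
          unfolding W_def by linarith
        then have "(2 powr (1 / \<xi>)) powr (real (multiplicity p b) * \<xi>) \<le> real p powr (real (multiplicity p b) * \<xi>)"
          using assms by (intro powr_mono2) auto
        also have "(2 powr (1 / \<xi>)) powr (real (multiplicity p b) * \<xi>) = 2 ^ multiplicity p b"
          using assms by (simp add: powr_powr powr_realpow)
        finally have "2 ^ multiplicity p b \<le> real p powr (real (multiplicity p b) * \<theta>)"
          by (simp add: \<theta>_eq)
        moreover have "real (multiplicity p b) + 1 \<le> 2 ^ multiplicity p b"
          using less_exp[of "multiplicity p b"]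
          by (metis Suc_eq_plus1 Suc_leI of_nat_1 of_nat_add of_nat_le_iff of_nat_numeral of_nat_power)
        ultimately show ?thesis using False by (simp add: c_def)
      qed
    qed
    have b_eq: "b = (\<Prod>p\<in>?P. p ^ multiplicity p b)"
      using b by (intro Primes.prime_factorization_nat) auto
    have "real (divisor_count b) = real (divisor_count (\<Prod>p\<in>?P. p ^ multiplicity p b))"
      using b_eq by simp
    also have "\<dots> \<le> real (\<Prod>p\<in>?P. multiplicity p b + 1)"
      by (subst of_nat_le_iff, rule divisor_count_prod_prime_powers_le) auto
    also have "\<dots> = (\<Prod>p\<in>?P. real (multiplicity p b) + 1)"
      by (simp add: add.commute)
    also have "\<dots> \<le> (\<Prod>p\<in>?P. c p * real p powr (real (multiplicity p b) * \<theta>))"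
      using local by (intro prod_mono) auto
    also have "\<dots> = (\<Prod>p\<in>?P. c p) * (\<Prod>p\<in>?P. real p powr (real (multiplicity p b) * \<theta>))"
      by (rule prod.distrib)
    also have "(\<Prod>p\<in>?P. real p powr (real (multiplicity p b) * \<theta>)) = (\<Prod>p\<in>?P. (real p ^ multiplicity p b) powr \<theta>)"
    proof (intro prod.cong refl)
      fix p assume "p \<in> ?P"
      then have "real p > 0" by (auto intro: prime_gt_0_nat)
      then show "real p powr (real (multiplicity p b) * \<theta>) = (real p ^ multiplicity p b) powr \<theta>"
        by (simp add: powr_powr flip: powr_realpow)
    qed
    also have "\<dots> = (\<Prod>p\<in>?P. real p ^ multiplicity p b) powr \<theta>"
      by (rule prod_powr_distrib [symmetric])
    also have "(\<Prod>p\<in>?P. real p ^ multiplicity p b) = real b"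
      by (subst (2) b_eq) simp
    also have "(\<Prod>p\<in>?P. c p) = (\<Prod>p\<in>?P \<inter> {..<W}. D)"
      unfolding c_def by (subst prod.inter_restrict) auto
    also have "\<dots> = D ^ card (?P \<inter> {..<W})" by simp
    also have "D ^ card (?P \<inter> {..<W}) * real b powr \<theta> \<le> D ^ W * real b powr \<theta>"
      using D card_mono[of "{..<W}" "?P \<inter> {..<W}"]
      by (intro mult_right_mono power_increasing) auto
    finally show ?thesis by (simp add: \<theta>_def)
  qed
  moreover have "D ^ W \<ge> 1" using D by simp
  ultimately show ?thesis by blast
qed

text \<open>The greedy factor \<open>a\<close> is obtained as the largest divisor up to
  \<open>z\<close> none of whose primes exceeds a prime of its cofactor. If \<open>P\<close> is the
  least prime of \<open>b\<close>, then \<open>a * P\<close> has the same ordering property, so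
  maximality forces it above \<open>z\<close>.\<close>

lemma smooth_rough_split:
  fixes z :: real
  assumes n: "n > 0" and z: "z \<ge> 1"
  obtains a b where "n = a * b" "real a \<le> z" "b = 1 \<or> (\<exists>P. prime P \<and> real a * real P > z \<and>
    (\<forall>p \<in> prime_factors a. p \<le> P) \<and> (\<forall>p \<in> prime_factors b. P \<le> p))"
proof -
  define S where "S = {a. a dvd n \<and> real a \<le> z \<and>
    (\<forall>p \<in> prime_factors a. \<forall>p' \<in> prime_factors (n div a). p \<le> p')}"
  have "finite S" using n unfolding S_def by (intro finite_subset[OF _ finite_divisors_nat[of n]]) auto
  moreover have "1 \<in> S" using z by (simp add: S_def)
  ultimately have Max_in: "Max S \<in> S" and Max_ge: "\<And>a. a \<in> S \<Longrightarrow> a \<le> Max S"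
    by (auto intro: Max_in)
  define a where "a = Max S"
  have a: "a dvd n" "real a \<le> z" "\<And>p p'. p \<in> prime_factors a \<Longrightarrow> p' \<in> prime_factors (n div a) \<Longrightarrow> p \<le> p'"
    using Max_in by (auto simp: S_def a_def)
  define b where "b = n div a"
  have nab: "n = a * b" using a by (simp add: b_def)
  have pos: "a > 0" "b > 0" using n nab by auto
  show thesis
  proof (cases "b = 1")
    case True
    then show ?thesis using that[of a b] a nab by blast
  next
    case False
    then have ne: "prime_factors b \<noteq> {}"
      using pos by (auto simp: prime_factorization_empty_iff)
    define P where "P = Min (prime_factors b)"
    have P: "P \<in> prime_factors b" "\<And>p. p \<in> prime_factors b \<Longrightarrow> P \<le> p"
      using ne by (auto simp: P_def)
    have Pp: "prime P" and Pb: "P dvd b" using P by auto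
    have "real a * real P > z"
    proof (rule ccontr)
      assume "\<not> real a * real P > z"
      then have le: "real (a * P) \<le> z" by simp
      obtain b' where b': "b = P * b'" using Pb by auto
      have "b' > 0" using pos b' by auto
      have ndiv: "n div (a * P) = b'"
        using nab b' pos Pp by (simp add: prime_gt_0_nat flip: mult.assoc)
      have "a * P \<in> S" unfolding S_def
      proof (intro CollectI conjI ballI)
        show "a * P dvd n" using nab b' by (simp flip: mult.assoc)
        fix p p' assume p: "p \<in> prime_factors (a * P)" and p': "p' \<in> prime_factors (n div (a * P))"
        have p'b: "p' \<in> prime_factors b"
          using p' \<open>b' > 0\<close> b' pos by (auto simp: ndiv prime_factors_dvd)
        have "p \<in> prime_factors a \<or> p = P"
          using p pos Pp by (auto simp: prime_factors_product prime_prime_factors prime_gt_0_nat)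
        then show "p \<le> p'" using a(3)[of p p'] p'b P(2) by (auto simp: b_def)
      qed (use le in auto)
      then have "a * P \<le> a" using Max_ge by (simp add: a_def)
      then show False using pos prime_ge_2_nat[OF Pp] by auto
    qed
    moreover have "\<forall>p \<in> prime_factors a. p \<le> P"
      using a(3) P(1) by (auto simp: b_def)
    ultimately show ?thesis using that[of a b] a nab Pp P(2) by blast
  qed
qed

section \<open>Primes and integers coprime to the modulus\<close>

lemma prod_primes_dvd:
  fixes n :: nat
  assumes "finite A" "\<And>p. p \<in> A \<Longrightarrow> prime p" "\<And>p. p \<in> A \<Longrightarrow> p dvd n"
  shows "\<Prod>A dvd n"
  using assms
proof (induction A rule: finite_induct)
  case (insert p A)
  have "coprime p (\<Prod>A)"
    using insert by (intro prod_coprime_right) (auto intro!: primes_coprime)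
  then show ?case using insert by (simp add: divides_mult)
qed auto

text \<open>Chebyshev's argument: a prime in this range divides \<open>fact (2 * n)\<close> but not
  \<open>fact n\<close>, hence it divides the central binomial coefficient.\<close>

lemma prod_primes_dyadic_le:
  "\<Prod>{p :: nat. prime p \<and> n < p \<and> p \<le> 2 * n} \<le> 4 ^ n"
proof -
  have "\<Prod>{p :: nat. prime p \<and> n < p \<and> p \<le> 2 * n} dvd (2 * n choose n)"
  proof (rule prod_primes_dvd)
    fix p assume "p \<in> {p :: nat. prime p \<and> n < p \<and> p \<le> 2 * n}"
    then have p: "prime p" "n < p" "p \<le> 2 * n" by auto
    have "p dvd fact (2 * n)" using p by (simp add: prime_dvd_fact_iff)
    also have "(fact (2 * n) :: nat) = fact n * fact n * (2 * n choose n)"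
      using binomial_fact_lemma[of n "2 * n"] by (simp add: mult_2)
    finally show "p dvd (2 * n choose n)"
      using p by (auto simp: prime_dvd_mult_iff prime_dvd_fact_iff)
  qed auto
  then have "\<Prod>{p :: nat. prime p \<and> n < p \<and> p \<le> 2 * n} \<le> (2 * n choose n)"
    by (rule dvd_imp_le) simp
  also have "\<dots> \<le> (\<Sum>k\<le>2 * n. 2 * n choose k)"
    by (rule member_le_sum) auto
  also have "\<dots> = 4 ^ n"
    by (simp add: choose_row_sum power_mult)
  finally show ?thesis .
qed

lemma sum_ln_over_primes_dyadic_le:
  assumes "n > 0"
  shows "(\<Sum>p | prime p \<and> n < p \<and> p \<le> 2 * n. ln (real p) / real p) \<le> ln 4"
proof -
  let ?A = "{p :: nat. prime p \<and> n < p \<and> p \<le> 2 * n}"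
  have "(\<Sum>p\<in>?A. ln (real p) / real p) \<le> (\<Sum>p\<in>?A. ln (real p) / real n)"
    using assms by (intro sum_mono divide_left_mono) auto
  also have "\<dots> = ln (\<Prod>p\<in>?A. real p) / real n"
  proof (subst ln_prod)
    show "real p \<noteq> 0" if "p \<in> ?A" for p using that by (auto simp: prime_gt_0_nat)
  qed (simp_all add: sum_divide_distrib)
  also have "real (\<Prod>?A) \<le> real (4 ^ n)"
    using prod_primes_dyadic_le[of n] by (subst of_nat_le_iff)
  then have "(\<Prod>p\<in>?A. real p) \<le> 4 ^ n" by simp
  then have "ln (\<Prod>p\<in>?A. real p) / real n \<le> ln (4 ^ n) / real n"
    by (intro divide_right_mono ln_mono prod_pos) (auto intro: prime_gt_0_nat)
  also have "\<dots> = ln 4"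
    using assms by (simp add: ln_realpow)
  finally show ?thesis .
qed

text \<open>Each dyadic block contributes at most \<open>ln 4\<close>. The result is the upper bound
  of Mertens' first theorem up to a factor 2.\<close>

lemma sum_ln_over_primes_le:
  "(\<Sum>p | prime p \<and> p \<le> 2 ^ k. ln (real p) / real p) \<le> real k * ln 4"
proof (induction k)
  case 0
  have "{p :: nat. prime p \<and> p \<le> 2 ^ 0} = {}"
    by (auto dest: prime_ge_2_nat)
  then show ?case by (simp only: sum.empty)
next
  case (Suc k)
  have "{p :: nat. prime p \<and> p \<le> 2 ^ Suc k} =
      {p. prime p \<and> p \<le> 2 ^ k} \<union> {p. prime p \<and> 2 ^ k < p \<and> p \<le> 2 * 2 ^ k}"
  proof (intro Set.set_eqI iffI)
    fix p :: nat
    assume "p \<in> {p. prime p \<and> p \<le> 2 ^ k} \<union> {p. prime p \<and> 2 ^ k < p \<and> p \<le> 2 * 2 ^ k}"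
    moreover have "(2 :: nat) ^ k \<le> 2 * 2 ^ k" by simp
    ultimately show "p \<in> {p :: nat. prime p \<and> p \<le> 2 ^ Suc k}"
      unfolding power_Suc by (blast intro: le_trans)
  qed (simp, linarith)
  then have "(\<Sum>p | prime p \<and> p \<le> 2 ^ Suc k. ln (real p) / real p) =
      (\<Sum>p | prime p \<and> p \<le> 2 ^ k. ln (real p) / real p) +
      (\<Sum>p | prime p \<and> 2 ^ k < p \<and> p \<le> 2 * 2 ^ k. ln (real p) / real p)"
    by (simp only:) (subst sum.union_disjoint, auto)
  also have "\<dots> \<le> real k * ln 4 + ln 4"
    using Suc sum_ln_over_primes_dyadic_le[of "2 ^ k"] by (intro add_mono) auto
  finally show ?case by (simp add: algebra_simps)
qed

section \<open>Harmonic sums over integers coprime to the modulus\<close>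

lemma sum_inverse_le_ln:
  "m > 0 \<Longrightarrow> (\<Sum>k=1..m. 1 / real k) \<le> 1 + ln (real m)"
proof (induction m rule: nat_induct_non_zero)
  case (Suc m)
  have "ln (real m / real (Suc m)) \<le> real m / real (Suc m) - 1"
    using Suc by (intro ln_le_minus_one) auto
  also have "\<dots> = - (1 / real (Suc m))"
    by (simp add: field_simps)
  finally have "1 / real (Suc m) \<le> ln (real (Suc m)) - ln (real m)"
    using Suc by (simp add: ln_div)
  with Suc show ?case by simp
qed simp

text \<open>The product over all \<open>k\<close> from 2 on telescopes and stays above 1/2. Factors
  outside \<open>P\<close> lie between 0 and 1, so leaving them out can only increase the
  product.\<close>

lemma prod_one_minus_inverse_square_ge:
  assumes "finite P" "\<And>p :: nat. p \<in> P \<Longrightarrow> p \<ge> 2"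
  shows "(\<Prod>p\<in>P. 1 - 1 / (real p)\<^sup>2) \<ge> 1 / 2"
proof -
  have tele: "(\<Prod>k=2..Suc m. 1 - 1 / (real k)\<^sup>2) = (real m + 2) / (2 * (real m + 1))" for m
  proof (induction m)
    case (Suc m)
    have "(\<Prod>k=2..Suc (Suc m). 1 - 1 / (real k)\<^sup>2) =
        (real m + 2) / (2 * (real m + 1)) * (1 - 1 / (real m + 2)\<^sup>2)"
      using Suc by (simp add: prod.nat_ivl_Suc' algebra_simps)
    also have "1 - 1 / (real m + 2)\<^sup>2 = (real m + 1) * (real m + 3) / (real m + 2)\<^sup>2"
      by (simp add: divide_simps power2_eq_square) (simp add: algebra_simps)
    also have "(real m + 2) / (2 * (real m + 1)) * ((real m + 1) * (real m + 3) / (real m + 2)\<^sup>2)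
        = (real m + 3) / (2 * (real m + 2))"
      by (simp add: divide_simps power2_eq_square) (simp add: algebra_simps)
    finally show ?case by (simp add: algebra_simps)
  qed simp
  obtain m where m: "P \<subseteq> {2..Suc m}"
  proof
    show "P \<subseteq> {2..Suc (Max P)}"
      using assms by (auto intro!: le_SucI Max_ge)
  qed
  have f: "0 \<le> 1 - 1 / (real p)\<^sup>2" "1 - 1 / (real p)\<^sup>2 \<le> 1" if "p \<ge> 2" for p :: nat
    using that by (auto simp: field_simps)
  have "1 / 2 \<le> (real m + 2) / (2 * (real m + 1))"
    by (simp add: field_simps)
  also have "\<dots> = (\<Prod>k\<in>{2..Suc m} - P. 1 - 1 / (real k)\<^sup>2) * (\<Prod>k\<in>P. 1 - 1 / (real k)\<^sup>2)"
    by (subst tele[symmetric], rule prod.subset_diff) (use m in auto)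
  also have "\<dots> \<le> 1 * (\<Prod>k\<in>P. 1 - 1 / (real k)\<^sup>2)"
    by (intro mult_right_mono prod_le_1 prod_nonneg conjI f) (use assms(2) in auto)
  finally show ?thesis by simp
qed

definition coprime_harmonic :: "nat \<Rightarrow> real \<Rightarrow> real" where
  "coprime_harmonic q z = (\<Sum>d | d > 0 \<and> real d \<le> z \<and> coprime d q. 1 / real d)"

lemma finite_real_le_nat: "finite {n :: nat. n > 0 \<and> real n \<le> x \<and> P n}"
  by (rule finite_subset[of _ "{..nat \<lfloor>x\<rfloor>}"]) (auto simp: le_nat_floor)

lemma coprime_harmonic_nonneg: "coprime_harmonic q z \<ge> 0"
  by (auto simp: coprime_harmonic_def intro!: sum_nonneg)

text \<open>The integers \<open>\<Prod>X * d\<close>, with \<open>X\<close> a set of primes of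
  \<open>q\<close>, are distinct and at most \<open>z * q\<close>, so multiplying by the product of
  the \<open>1 + 1 / p\<close> gives at most a full harmonic sum. Multiplying further by the
  \<open>1 - 1 / p\<close> brings in the totient, and the two products together are at least
  1/2.\<close>

lemma coprime_harmonic_le:
  assumes q: "q > 0" and z: "z \<ge> 1"
  shows "coprime_harmonic q z \<le> 2 * (real (totient q) / real q) * (1 + ln (z * real q))"
proof -
  let ?P = "prime_factors q"
  let ?D = "{d. d > 0 \<and> real d \<le> z \<and> coprime d q}"
  define m where "m = nat \<lfloor>z * real q\<rfloor>"
  have "z * real q \<ge> 1 * 1" using q z by (intro mult_mono) auto
  then have m: "m > 0" "real m \<le> z * real q" by (auto simp: m_def)
  have prod_dvd: "\<Prod>X dvd q" if "X \<subseteq> ?P" for X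
    using that by (intro prod_primes_dvd) (auto intro: finite_subset)
  have fin: "finite ?D" by (rule finite_real_le_nat)
  have fact: "(\<Prod>p\<in>?P. 1 + 1 / real p) = (\<Sum>X\<in>Pow ?P. 1 / real (\<Prod>X))"
  proof -
    have "(\<Prod>p\<in>?P. 1 / real p + 1) = (\<Sum>X\<in>Pow ?P. (\<Prod>p\<in>X. 1 / real p) * (\<Prod>p\<in>?P - X. 1))"
      by (rule prod_add) auto
    then show ?thesis by (simp add: add.commute prod_dividef)
  qed
  have inj: "inj_on (\<lambda>(X, d). \<Prod>X * d) (Pow ?P \<times> ?D)"
  proof (rule inj_onI, clarify)
    fix X d X' d'
    assume X: "X \<subseteq> ?P" "X' \<subseteq> ?P" and d: "d > 0" "d' > 0" "coprime d q" "coprime d' q"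
      and eq: "\<Prod>X * d = \<Prod>X' * d'"
    \<comment> \<open>\<open>X\<close> can be read off from \<open>\<Prod>X * d\<close>: as
      \<open>d\<close> is coprime to \<open>q\<close>, the primes of \<open>q\<close> that divide
      this product are exactly those in \<open>X\<close>.\<close>
    have char: "p \<in> Y \<longleftrightarrow> p \<in> ?P \<and> p dvd \<Prod>Y * e" if Y: "Y \<subseteq> ?P" and e: "coprime e q" for Y e p
    proof
      assume "p \<in> Y"
      moreover have "finite Y" using Y by (auto intro: finite_subset)
      ultimately show "p \<in> ?P \<and> p dvd \<Prod>Y * e"
        using Y by (auto intro!: dvd_mult2 dvd_prodI)
    next
      assume p: "p \<in> ?P \<and> p dvd \<Prod>Y * e"
      then have pp: "prime p" "p dvd q" by auto
      have "\<not> p dvd e"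
        using pp e by (metis coprime_common_divisor not_prime_unit)
      with p pp have "p dvd \<Prod>Y" by (simp add: prime_dvd_mult_iff)
      moreover have "finite Y" using Y by (auto intro: finite_subset)
      ultimately obtain p' where "p' \<in> Y" "p dvd p'"
        using pp(1) by (auto simp: prime_dvd_prod_iff)
      moreover from this Y have "prime p'" by auto
      ultimately show "p \<in> Y" using pp(1) primes_dvd_imp_eq by blast
    qed
    have XX: "X = X'"
      using char[OF X(1) d(3)] char[OF X(2) d(4)] eq by (metis subsetI subset_antisym)
    moreover have "\<Prod>X \<noteq> 0"
      using prod_dvd[OF X(1)] q by (metis dvd_0_left_iff less_irrefl)
    ultimately show "X = X' \<and> d = d'" using eq by simp
  qed
  have "coprime_harmonic q z * (\<Prod>p\<in>?P. 1 + 1 / real p)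
      = (\<Sum>X\<in>Pow ?P. \<Sum>d\<in>?D. 1 / real (\<Prod>X * d))"
    unfolding fact coprime_harmonic_def by (simp add: sum_product sum.swap[of _ ?D] mult.commute)
  also have "\<dots> = (\<Sum>k\<in>(\<lambda>(X, d). \<Prod>X * d) ` (Pow ?P \<times> ?D). 1 / real k)"
    by (subst sum.reindex[OF inj], subst sum.cartesian_product) (simp add: case_prod_unfold o_def)
  also have "\<dots> \<le> (\<Sum>k=1..m. 1 / real k)"
  proof (rule sum_mono2)
    show "(\<lambda>(X, d). \<Prod>X * d) ` (Pow ?P \<times> ?D) \<subseteq> {1..m}"
    proof clarify
      fix X d assume X: "X \<subseteq> ?P" and d: "d > 0" "real d \<le> z" "coprime d q"
      have "\<Prod>X \<le> q" "\<Prod>X > 0" using prod_dvd[OF X] q by (auto simp: dvd_imp_le intro: Nat.gr0I)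
      then have "real (\<Prod>X) * real d \<le> real q * z"
        using d by (intro mult_mono of_nat_mono) auto
      then have "\<Prod>X * d \<le> m" unfolding m_def
        by (intro le_nat_floor) (simp add: mult.commute)
      then show "\<Prod>X * d \<in> {1..m}" using d \<open>\<Prod>X > 0\<close> by (simp add: Suc_le_eq)
    qed
  qed auto
  also have "\<dots> \<le> 1 + ln (real m)" using m by (intro sum_inverse_le_ln)
  also have "\<dots> \<le> 1 + ln (z * real q)" using m by simp
  finally have main: "coprime_harmonic q z * (\<Prod>p\<in>?P. 1 + 1 / real p) \<le> 1 + ln (z * real q)" .
  have tot: "real (totient q) / real q = (\<Prod>p\<in>?P. 1 - 1 / real p)"
    using q by (simp add: totient_formula2)
  have tnn: "(\<Prod>p\<in>?P. 1 - 1 / real p) \<ge> 0"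
  proof (rule prod_nonneg)
    fix p assume "p \<in> ?P"
    then have "p > 0" by (auto intro: prime_gt_0_nat)
    then show "0 \<le> 1 - 1 / real p" by simp
  qed
  have "(\<Prod>p\<in>?P. 1 + 1 / real p) * (\<Prod>p\<in>?P. 1 - 1 / real p) = (\<Prod>p\<in>?P. 1 - 1 / (real p)\<^sup>2)"
    by (simp add: algebra_simps power2_eq_square flip: prod.distrib)
  also have "\<dots> \<ge> 1 / 2"
    by (rule prod_one_minus_inverse_square_ge) (auto dest: in_prime_factors_imp_prime prime_ge_2_nat)
  finally have half: "1 / 2 \<le> (\<Prod>p\<in>?P. 1 + 1 / real p) * (\<Prod>p\<in>?P. 1 - 1 / real p)" .
  have "coprime_harmonic q z * (1 / 2)
      \<le> coprime_harmonic q z * ((\<Prod>p\<in>?P. 1 + 1 / real p) * (\<Prod>p\<in>?P. 1 - 1 / real p))"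
    using half coprime_harmonic_nonneg by (intro mult_left_mono)
  also have "\<dots> = coprime_harmonic q z * (\<Prod>p\<in>?P. 1 + 1 / real p) * (\<Prod>p\<in>?P. 1 - 1 / real p)"
    by simp
  also have "\<dots> \<le> (1 + ln (z * real q)) * (\<Prod>p\<in>?P. 1 - 1 / real p)"
    using main tnn by (rule mult_right_mono)
  finally show ?thesis by (simp add: tot mult_ac)
qed

section \<open>Counting in arithmetic progressions\<close>

lemma card_cong_interval_le:
  fixes x y :: real and S :: "nat set"
  assumes m: "m > 0" and y: "y \<ge> 0"
    and S: "\<And>n. n \<in> S \<Longrightarrow> x < real n \<and> real n \<le> x + y"
    and cong: "\<And>n n'. n \<in> S \<Longrightarrow> n' \<in> S \<Longrightarrow> [n = n'] (mod m)"
  shows "real (card S) \<le> y / real m + 1"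
proof (cases "S = {}")
  case False
  have fin: "finite S"
    by (rule finite_subset[of _ "{..nat \<lfloor>x + y\<rfloor>}"]) (use S in \<open>auto simp: le_nat_floor\<close>)
  define n0 where "n0 = Min S"
  have n0: "n0 \<in> S" "\<And>n. n \<in> S \<Longrightarrow> n0 \<le> n" using fin False by (auto simp: n0_def)
  have dv: "m dvd n - n0" if "n \<in> S" for n
    using cong[OF that n0(1)] n0(2)[OF that] by (simp add: cong_altdef_nat)
  have inj: "inj_on (\<lambda>n. (n - n0) div m) S"
  proof (rule inj_onI)
    fix n n' assume n: "n \<in> S" "n' \<in> S" and eq: "(n - n0) div m = (n' - n0) div m"
    then have "n - n0 = n' - n0" using dv[of n] dv[of n'] by (metis dvd_div_mult_self)
    then show "n = n'" using n0(2)[of n] n0(2)[of n'] n by linarith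
  qed
  have "(\<lambda>n. (n - n0) div m) ` S \<subseteq> {..nat \<lfloor>y / real m\<rfloor>}"
  proof (rule image_subsetI)
    fix n assume n: "n \<in> S"
    have "real ((n - n0) div m) \<le> real (n - n0) / real m"
      by (rule of_nat_div_le_of_nat)
    also have "real (n - n0) \<le> y"
      using n0 n S[OF n] S[OF n0(1)] by (simp add: of_nat_diff)
    then have "real (n - n0) / real m \<le> y / real m" by (intro divide_right_mono) auto
    finally show "(n - n0) div m \<in> {..nat \<lfloor>y / real m\<rfloor>}" by (simp add: le_nat_floor)
  qed
  then have "card ((\<lambda>n. (n - n0) div m) ` S) \<le> card {..nat \<lfloor>y / real m\<rfloor>}"
    by (intro card_mono) auto
  then have "card S \<le> nat \<lfloor>y / real m\<rfloor> + 1" using inj by (simp add: card_image)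
  moreover have "real (nat \<lfloor>y / real m\<rfloor>) \<le> y / real m" using y by simp
  ultimately show ?thesis by linarith
qed (use y in simp)

text \<open>For \<open>l\<close> coprime to \<open>q\<close> the two conditions fix a single class
  modulo \<open>q * l\<close>. Otherwise there is no such \<open>n\<close>, because \<open>n\<close>
  inherits coprimality to \<open>q\<close> from \<open>r\<close>.\<close>

lemma card_progression_multiples_le:
  fixes x y :: real
  assumes "q > 0" "l > 0" "y \<ge> 0" "coprime r (int q)"
  shows "real (card {n. n > 0 \<and> x < real n \<and> real n \<le> x + y \<and> [int n = r] (mod int q) \<and> l dvd n})
           \<le> y / real (q * l) + 1"
proof (cases "coprime q l")
  case True
  show ?thesis
  proof (rule card_cong_interval_le[where x = x])
    fix n n'
    assume "n \<in> {n. n > 0 \<and> x < real n \<and> real n \<le> x + y \<and> [int n = r] (mod int q) \<and> l dvd n}"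
      and "n' \<in> {n. n > 0 \<and> x < real n \<and> real n \<le> x + y \<and> [int n = r] (mod int q) \<and> l dvd n}"
    then have *: "[int n = r] (mod int q)" "[int n' = r] (mod int q)" "l dvd n" "l dvd n'" by auto
    then have "[int n = int n'] (mod int q)" by (meson cong_sym cong_trans)
    then have "[n = n'] (mod q)" by (simp add: cong_int_iff)
    moreover have "[n = n'] (mod l)" using * by (simp add: cong_def)
    ultimately show "[n = n'] (mod (q * l))" using True by (simp add: coprime_cong_mult_nat)
  qed (use assms in auto)
next
  case False
  have "{n. n > 0 \<and> x < real n \<and> real n \<le> x + y \<and> [int n = r] (mod int q) \<and> l dvd n} = {}"
  proof (rule ccontr)
    assume "{n. n > 0 \<and> x < real n \<and> real n \<le> x + y \<and> [int n = r] (mod int q) \<and> l dvd n} \<noteq> {}"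
    then obtain n where n: "[int n = r] (mod int q)" "l dvd n" by auto
    then have "coprime (int n) (int q)" using assms(4) by (meson cong_imp_coprime cong_sym)
    then have "coprime n q" by simp
    then show False using False n by (metis coprime_commute coprime_divisors dvd_refl)
  qed
  then show ?thesis using assms by (simp only: card.empty) simp
qed

section \<open>Rankin weights\<close>

text \<open>The values at \<open>p ^ k\<close> of the multiplicative function whose sum over the divisors of \<open>n\<close> is
  \<open>n powr \<beta>\<close>. Majorising \<open>a powr \<beta>\<close> by a divisor sum is what keeps the loss in Rankin's trick bounded:
  the Euler product below involves \<open>\<Sum>p\<le>w. \<beta> ln p / p\<close>, which is \<open>O(1)\<close> for \<open>\<beta> = O(1 / ln w)\<close>, instead of
  \<open>\<Sum>p\<le>w. 1 / p\<close>.\<close>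

definition rankin_weight :: "real \<Rightarrow> nat \<Rightarrow> nat \<Rightarrow> real" where
  "rankin_weight \<beta> p k =
     (if k = 0 then 1 else real p powr (real k * \<beta>) - real p powr (real (k - 1) * \<beta>))"

lemma rankin_weight_nonneg:
  assumes "p \<ge> 1" "\<beta> \<ge> 0"
  shows "rankin_weight \<beta> p k \<ge> 0"
  using assms by (auto simp: rankin_weight_def intro!: powr_mono mult_right_mono)

lemma sum_rankin_weight:
  assumes "p \<ge> 1"
  shows "(\<Sum>k\<le>m. rankin_weight \<beta> p k) = real p powr (real m * \<beta>)"
  using assms by (induction m) (auto simp: rankin_weight_def)

text \<open>At each prime the weights up to the exact multiplicity telescope, and expanding the
  product of these sums gives one term per divisor of \<open>a\<close>. The common box
  \<open>{..L}\<close> lets \<open>f\<close> range over the same set for all \<open>a\<close>, so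
  that sums over \<open>f\<close> and over integers can be interchanged later.\<close>

lemma powr_le_sum_rankin_weight:
  assumes A: "finite A" "\<And>p. p \<in> A \<Longrightarrow> prime p" and a: "a > 0" "prime_factors a \<subseteq> A"
    and L: "\<And>p. p \<in> A \<Longrightarrow> multiplicity p a \<le> L" and \<beta>: "\<beta> \<ge> 0"
  shows "real a powr \<beta> \<le> (\<Sum>f | f \<in> A \<rightarrow>\<^sub>E {..L} \<and> (\<Prod>p\<in>A. p ^ f p) dvd a.
           \<Prod>p\<in>A. rankin_weight \<beta> p (f p))"
proof -
  have p1: "p \<ge> 1" if "p \<in> A" for p
    using prime_ge_1_nat[OF A(2)[OF that]] by simp
  have a_eq: "a = (\<Prod>p\<in>A. p ^ multiplicity p a)"
  proof -
    have "a = (\<Prod>p\<in>prime_factors a. p ^ multiplicity p a)"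
      using a by (intro Primes.prime_factorization_nat) auto
    also have "\<dots> = (\<Prod>p\<in>A. p ^ multiplicity p a)"
      using A a by (intro prod.mono_neutral_left) (auto simp: prime_factors_multiplicity)
    finally show ?thesis .
  qed
  have "real a powr \<beta> = (\<Prod>p\<in>A. real p ^ multiplicity p a) powr \<beta>"
    by (subst a_eq) simp
  also have "\<dots> = (\<Prod>p\<in>A. (real p ^ multiplicity p a) powr \<beta>)"
    by (rule prod_powr_distrib)
  also have "\<dots> = (\<Prod>p\<in>A. \<Sum>k\<le>multiplicity p a. rankin_weight \<beta> p k)"
  proof (intro prod.cong refl)
    fix p assume "p \<in> A"
    then have "p \<ge> 1" by (rule p1)
    then show "(real p ^ multiplicity p a) powr \<beta> = (\<Sum>k\<le>multiplicity p a. rankin_weight \<beta> p k)"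
      by (simp add: sum_rankin_weight powr_powr flip: powr_realpow)
  qed
  also have "\<dots> = (\<Sum>f\<in>Pi\<^sub>E A (\<lambda>p. {..multiplicity p a}). \<Prod>p\<in>A. rankin_weight \<beta> p (f p))"
    using A by (intro prod_sum_PiE) auto
  also have "\<dots> \<le> (\<Sum>f | f \<in> A \<rightarrow>\<^sub>E {..L} \<and> (\<Prod>p\<in>A. p ^ f p) dvd a.
           \<Prod>p\<in>A. rankin_weight \<beta> p (f p))"
  proof (rule sum_mono2)
    have "finite (A \<rightarrow>\<^sub>E {..L})" using A by (intro finite_PiE) auto
    then show "finite {f. f \<in> A \<rightarrow>\<^sub>E {..L} \<and> (\<Prod>p\<in>A. p ^ f p) dvd a}" by simp
    show "Pi\<^sub>E A (\<lambda>p. {..multiplicity p a}) \<subseteq> {f. f \<in> A \<rightarrow>\<^sub>E {..L} \<and> (\<Prod>p\<in>A. p ^ f p) dvd a}"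
    proof (intro subsetI CollectI conjI)
      fix f assume f: "f \<in> Pi\<^sub>E A (\<lambda>p. {..multiplicity p a})"
      have le: "f p \<le> multiplicity p a" if "p \<in> A" for p using PiE_mem[OF f that] by simp
      show "f \<in> A \<rightarrow>\<^sub>E {..L}"
        using f le L by (auto simp: PiE_iff intro: order_trans)
      have "(\<Prod>p\<in>A. p ^ f p) dvd (\<Prod>p\<in>A. p ^ multiplicity p a)"
        using le by (intro prod_dvd_prod le_imp_power_dvd)
      then show "(\<Prod>p\<in>A. p ^ f p) dvd a" using a_eq by simp
    qed
  qed (use p1 \<beta> in \<open>auto intro!: prod_nonneg rankin_weight_nonneg\<close>)
  finally show ?thesis .
qed

text \<open>The ratio \<open>3/5\<close> is an upper bound for \<open>p powr \<beta> / p\<close>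
  when \<open>\<beta> \<le> 1/4\<close>, and the limit \<open>35/4\<close> is the source of the
  constant 9 in the next lemma.\<close>

lemma sum_arith_geometric: "(\<Sum>k<n. (real k + 2) * (3/5) ^ k) = 35/4 - (3/5) ^ n * (5/2 * real n + 35/4)"
proof (induction n)
  case (Suc n)
  have "(\<Sum>k<Suc n. (real k + 2) * (3/5) ^ k)
      = 35/4 - (3/5) ^ n * (5/2 * real n + 35/4) + (real n + 2) * (3/5) ^ n"
    using Suc by simp
  also have "\<dots> = 35/4 - (3/5) ^ Suc n * (5/2 * real (Suc n) + 35/4)"
    by (simp add: algebra_simps)
  finally show ?case .
qed simp

text \<open>With \<open>s = p powr \<beta>\<close>, the weight at a positive exponent
  \<open>k\<close> is \<open>s ^ k * (1 - 1 / s)\<close>, and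
  \<open>1 - 1 / s \<le> \<beta> * ln p\<close>. This small factor is gained at every term; what
  remains is an arithmetic-geometric series with ratio \<open>s / p\<close>.\<close>

lemma rankin_local_factor_le:
  assumes p: "prime p" and \<beta>: "0 \<le> \<beta>" "\<beta> \<le> 1/4"
  shows "(\<Sum>k\<le>L. rankin_weight \<beta> p k * (real k + 1) / real p ^ k)
           \<le> 1 + 9 * \<beta> * real p powr \<beta> * (ln (real p) / real p)"
proof -
  have p2: "real p \<ge> 2" using prime_ge_2_nat[OF p] by simp
  define s where "s = real p powr \<beta>"
  have s1: "s \<ge> 1" using p2 \<beta> by (simp add: s_def ge_one_powr_ge_zero)
  have sp: "s / real p \<le> 3 / 5"
  proof -
    have "s \<le> real p powr (1/4)" unfolding s_def using p2 \<beta> by (intro powr_mono) auto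
    then have "s / real p \<le> real p powr (1/4) / real p powr 1" using p2 by (simp add: divide_right_mono)
    also have "\<dots> = real p powr (-(3/4))" by (subst powr_diff[symmetric]) simp
    also have "\<dots> \<le> 2 powr (-(3/4))" using p2 by (intro powr_mono2') auto
    \<comment> \<open>Fourth powers are compared: \<open>1/8\<close> is at most
      \<open>81/625\<close>.\<close>
    also have "\<dots> \<le> 3/5"
    proof (rule power_le_imp_le_base[of _ 3])
      have "(2 powr (-(3/4)) :: real) ^ Suc 3 = 2 powr (-3)"
        by (subst powr_realpow[symmetric]) (auto simp: powr_powr)
      also have "\<dots> = 1 / 8" by (simp add: powr_minus powr_numeral)
      also have "\<dots> \<le> (3/5) ^ Suc 3" by (simp add: power_divide)
      finally show "(2 powr (-(3/4)) :: real) ^ Suc 3 \<le> (3/5) ^ Suc 3" .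
    qed auto
    finally show ?thesis .
  qed
  have w: "rankin_weight \<beta> p (Suc j) \<le> s ^ Suc j * (\<beta> * ln (real p))" for j
  proof -
    have pow: "real p powr (real k * \<beta>) = s ^ k" for k
      using p2 by (simp add: s_def powr_powr mult.commute flip: powr_realpow)
    have "1 - \<beta> * ln (real p) \<le> exp (- (\<beta> * ln (real p)))"
      using exp_ge_add_one_self[of "- (\<beta> * ln (real p))"] by simp
    also have "\<dots> = 1 / s"
      using p2 by (simp add: s_def powr_def exp_minus inverse_eq_divide)
    finally have *: "1 - 1 / s \<le> \<beta> * ln (real p)" by simp
    have "rankin_weight \<beta> p (Suc j) = s ^ Suc j - s ^ j"
      using pow[of "Suc j"] pow[of j] by (simp add: rankin_weight_def)
    also have "\<dots> = s ^ Suc j * (1 - 1 / s)"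
      using s1 by (simp add: field_simps)
    also have "\<dots> \<le> s ^ Suc j * (\<beta> * ln (real p))"
      using * s1 by (intro mult_left_mono) auto
    finally show ?thesis .
  qed
  have summand: "rankin_weight \<beta> p (Suc j) * (real (Suc j) + 1) / real p ^ Suc j
      \<le> \<beta> * s * (ln (real p) / real p) * ((real j + 2) * (3/5) ^ j)" for j
  proof -
    have "rankin_weight \<beta> p (Suc j) * (real (Suc j) + 1) / real p ^ Suc j
        \<le> s ^ Suc j * (\<beta> * ln (real p)) * (real (Suc j) + 1) / real p ^ Suc j"
      using w by (intro divide_right_mono mult_right_mono) auto
    also have "\<dots> = \<beta> * s * (ln (real p) / real p) * ((real j + 2) * (s / real p) ^ j)"
      by (simp add: power_divide)
    also have "\<dots> \<le> \<beta> * s * (ln (real p) / real p) * ((real j + 2) * (3/5) ^ j)"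
      using sp s1 p2 \<beta> by (intro mult_left_mono power_mono mult_nonneg_nonneg) auto
    finally show ?thesis .
  qed
  have "(\<Sum>k\<le>L. rankin_weight \<beta> p k * (real k + 1) / real p ^ k)
      = 1 + (\<Sum>j<L. rankin_weight \<beta> p (Suc j) * (real (Suc j) + 1) / real p ^ Suc j)"
    by (subst sum.atMost_shift) (simp add: rankin_weight_def)
  also have "\<dots> \<le> 1 + (\<Sum>j<L. \<beta> * s * (ln (real p) / real p) * ((real j + 2) * (3/5) ^ j))"
    using summand by (intro add_left_mono sum_mono) auto
  also have "\<dots> = 1 + \<beta> * s * (ln (real p) / real p) * (\<Sum>j<L. (real j + 2) * (3/5) ^ j)"
    by (simp add: sum_distrib_left)
  also have "\<dots> \<le> 1 + \<beta> * s * (ln (real p) / real p) * 9"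
    unfolding sum_arith_geometric using s1 p2 \<beta>
    by (intro add_left_mono mult_left_mono mult_nonneg_nonneg)
       (auto intro: order_trans[of _ "35/4"] mult_nonneg_nonneg)
  finally show ?thesis by (simp add: s_def mult_ac)
qed

text \<open>By \<open>1 + t \<le> exp t\<close> the product is at most the exponential of a multiple
  of \<open>\<beta>\<close> times the sum of \<open>ln p / p\<close>, which is \<open>O(M)\<close>.
  The hypothesis on \<open>\<beta> * M\<close> controls this sum and also
  \<open>p powr \<beta>\<close>, so the bound depends on \<open>B\<close> alone.\<close>

lemma rankin_euler_product_le:
  assumes \<beta>: "0 \<le> \<beta>" "\<beta> \<le> 1/4" and B: "\<beta> * real M \<le> B"
  shows "(\<Prod>p | prime p \<and> p \<le> 2 ^ M. \<Sum>k\<le>L. rankin_weight \<beta> p k * (real k + 1) / real p ^ k)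
           \<le> exp (9 * 2 powr B * B * ln 4)"
proof -
  let ?A = "{p :: nat. prime p \<and> p \<le> 2 ^ M}"
  have B0: "B \<ge> 0" using \<beta> B by (meson mult_nonneg_nonneg of_nat_0_le_iff order_trans)
  have "(\<Prod>p\<in>?A. \<Sum>k\<le>L. rankin_weight \<beta> p k * (real k + 1) / real p ^ k)
      \<le> (\<Prod>p\<in>?A. exp (9 * 2 powr B * \<beta> * (ln (real p) / real p)))"
  proof (rule prod_mono, intro conjI)
    fix p assume "p \<in> ?A"
    then have p: "prime p" "p \<le> 2 ^ M" by auto
    have p1: "p \<ge> 1" using prime_ge_1_nat[OF p(1)] by simp
    show "0 \<le> (\<Sum>k\<le>L. rankin_weight \<beta> p k * (real k + 1) / real p ^ k)"
      using p1 \<beta> by (intro sum_nonneg divide_nonneg_nonneg mult_nonneg_nonneg rankin_weight_nonneg) auto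
    have "real p \<le> real (2 ^ M)" using p by (subst of_nat_le_iff)
    then have "real p powr \<beta> \<le> (2 powr real M) powr \<beta>"
      using \<beta> by (intro powr_mono2) (auto simp: powr_realpow)
    also have "\<dots> = 2 powr (\<beta> * real M)" by (simp add: powr_powr mult.commute)
    also have "\<dots> \<le> 2 powr B" using B by (intro powr_mono) auto
    finally have pB: "real p powr \<beta> \<le> 2 powr B" .
    have "(\<Sum>k\<le>L. rankin_weight \<beta> p k * (real k + 1) / real p ^ k)
        \<le> 1 + 9 * \<beta> * real p powr \<beta> * (ln (real p) / real p)"
      using p(1) \<beta> by (rule rankin_local_factor_le)
    also have "\<dots> \<le> 1 + 9 * \<beta> * 2 powr B * (ln (real p) / real p)"
      using pB p1 \<beta> by (intro add_left_mono mult_right_mono mult_left_mono) auto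
    also have "\<dots> \<le> exp (9 * \<beta> * 2 powr B * (ln (real p) / real p))"
      by (rule exp_ge_add_one_self)
    finally show "(\<Sum>k\<le>L. rankin_weight \<beta> p k * (real k + 1) / real p ^ k)
        \<le> exp (9 * 2 powr B * \<beta> * (ln (real p) / real p))" by (simp add: mult_ac)
  qed
  also have "\<dots> = exp (9 * 2 powr B * \<beta> * (\<Sum>p\<in>?A. ln (real p) / real p))"
    by (simp add: exp_sum sum_distrib_left)
  also have "\<dots> \<le> exp (9 * 2 powr B * \<beta> * (real M * ln 4))"
    using sum_ln_over_primes_le[of M] \<beta> by (auto intro!: mult_left_mono)
  also have "9 * 2 powr B * \<beta> * (real M * ln 4) = 9 * 2 powr B * (\<beta> * real M) * ln 4"
    by simp
  also have "exp \<dots> \<le> exp (9 * 2 powr B * B * ln 4)"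
    using B by (auto intro!: mult_left_mono mult_right_mono)
  finally show ?thesis .
qed

section \<open>Sums of \<open>tau_le z\<close> over multiples of a fixed integer\<close>

text \<open>The gcd is one of the common divisors \<open>e\<close> of \<open>u\<close> and
  \<open>d\<close>, so it is at most their sum. For fixed \<open>e\<close>, writing
  \<open>d = e * k\<close> turns \<open>e / d\<close> into \<open>1 / k\<close> with
  \<open>k\<close> again coprime to \<open>q\<close> and at most \<open>z\<close>.\<close>

lemma sum_gcd_over_le:
  assumes u: "u > 0"
  shows "(\<Sum>d | d > 0 \<and> real d \<le> z \<and> coprime d q. real (gcd u d) / real d)
           \<le> real (divisor_count u) * coprime_harmonic q z"
proof -
  let ?D = "{d. d > 0 \<and> real d \<le> z \<and> coprime d q}"
  have fin: "finite ?D" by (rule finite_real_le_nat)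
  have finu: "finite {e. e dvd u}" using u by simp
  have "(\<Sum>d\<in>?D. real (gcd u d) / real d)
      \<le> (\<Sum>d\<in>?D. \<Sum>e | e dvd u. if e dvd d then real e / real d else 0)"
  proof (rule sum_mono)
    fix d assume "d \<in> ?D"
    have "real (gcd u d) / real d = (if gcd u d dvd d then real (gcd u d) / real d else 0)" by simp
    also have "\<dots> \<le> (\<Sum>e | e dvd u. if e dvd d then real e / real d else 0)"
      by (rule member_le_sum[where f = "\<lambda>e. if e dvd d then real e / real d else 0"]) (use u in auto)
    finally show "real (gcd u d) / real d \<le> (\<Sum>e | e dvd u. if e dvd d then real e / real d else 0)" .
  qed
  also have "\<dots> = (\<Sum>e | e dvd u. \<Sum>d\<in>?D. if e dvd d then real e / real d else 0)"
    by (rule sum.swap)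
  also have "\<dots> \<le> (\<Sum>e | e dvd u. coprime_harmonic q z)"
  proof (rule sum_mono)
    fix e assume "e \<in> {e. e dvd u}"
    then have e: "e > 0" using u by (auto intro: Nat.gr0I)
    have "(\<Sum>d\<in>?D. if e dvd d then real e / real d else 0) = (\<Sum>d\<in>{d\<in>?D. e dvd d}. real e / real d)"
      by (rule sum.inter_filter[OF fin, symmetric])
    also have "\<dots> = (\<Sum>k\<in>(\<lambda>d. d div e) ` {d\<in>?D. e dvd d}. 1 / real k)"
    proof (subst sum.reindex)
      show "inj_on (\<lambda>d. d div e) {d\<in>?D. e dvd d}"
        by (intro inj_onI) (auto elim!: dvdE simp: e)
    qed (use e in \<open>auto intro!: sum.cong elim!: dvdE\<close>)
    also have "\<dots> \<le> (\<Sum>k\<in>?D. 1 / real k)"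
    proof (rule sum_mono2)
      show "(\<lambda>d. d div e) ` {d\<in>?D. e dvd d} \<subseteq> ?D"
      proof (rule image_subsetI)
        fix d assume "d \<in> {d\<in>?D. e dvd d}"
        then have d: "d > 0" "real d \<le> z" "coprime d q" "e dvd d" by auto
        then have "d div e dvd d" by auto
        have "d div e > 0" using d e by (auto elim!: dvdE)
        moreover have "real (d div e) \<le> z" using d(2) div_le_dividend[of d e] by linarith
        moreover have "coprime (d div e) q"
          using d(3) \<open>d div e dvd d\<close> by (meson coprime_divisors dvd_refl)
        ultimately show "d div e \<in> ?D" by simp
      qed
    qed (use fin in auto)
    finally show "(\<Sum>d\<in>?D. if e dvd d then real e / real d else 0) \<le> coprime_harmonic q z"
      by (simp add: coprime_harmonic_def)
  qed
  also have "\<dots> = real (divisor_count u) * coprime_harmonic q z"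
    by (simp add: divisor_count_def)
  finally show ?thesis .
qed

text \<open>Interchanging summations leaves, for each \<open>d\<close>, the multiples of
  \<open>lcm u d\<close>, and \<open>1 / lcm u d\<close> is \<open>gcd u d / (u * d)\<close>. Since
  \<open>n\<close> is coprime to \<open>q\<close>, only \<open>d\<close> coprime to \<open>q\<close>
  occur; this restriction is the origin of the saving \<open>totient q / q\<close>.\<close>

lemma sum_tau_le_multiples_le:
  fixes z Y :: real
  assumes A: "finite A" "\<And>n. n \<in> A \<Longrightarrow> coprime n q" and Y: "Y \<ge> 0"
    and count: "\<And>l. l > 0 \<Longrightarrow> real l \<le> u * z \<Longrightarrow> real (card {n \<in> A. l dvd n}) \<le> Y / real l"
    and u: "u > 0"
  shows "(\<Sum>n | n \<in> A \<and> u dvd n. real (tau_le z n))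
           \<le> Y * coprime_harmonic q z * (real (divisor_count u) / real u)"
proof -
  let ?D = "{d. d > 0 \<and> real d \<le> z \<and> coprime d q}"
  have fin: "finite ?D" by (rule finite_real_le_nat)
  have "(\<Sum>n | n \<in> A \<and> u dvd n. real (tau_le z n)) = (\<Sum>n | n \<in> A \<and> u dvd n. \<Sum>d\<in>?D. if d dvd n then 1 else 0)"
  proof (rule sum.cong[OF refl])
    fix n assume "n \<in> {n. n \<in> A \<and> u dvd n}"
    then have "coprime n q" using A by auto
    then have "{d. d > 0 \<and> real d \<le> z \<and> d dvd n} = {d \<in> ?D. d dvd n}"
      by (auto intro: coprime_divisors[OF _ dvd_refl])
    then show "real (tau_le z n) = (\<Sum>d\<in>?D. if d dvd n then 1 else 0)"
      using fin by (simp add: tau_le_def sum.inter_filter[symmetric])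
  qed
  also have "\<dots> = (\<Sum>d\<in>?D. \<Sum>n | n \<in> A \<and> u dvd n. if d dvd n then 1 else 0)"
    by (rule sum.swap)
  also have "\<dots> \<le> (\<Sum>d\<in>?D. Y / real u * (real (gcd u d) / real d))"
  proof (rule sum_mono)
    fix d assume "d \<in> ?D"
    then have d: "d > 0" "real d \<le> z" by auto
    have "(\<Sum>n | n \<in> A \<and> u dvd n. if d dvd n then 1 else 0) = real (card {n \<in> {n. n \<in> A \<and> u dvd n}. d dvd n})"
      using A by (simp add: sum.inter_filter[symmetric])
    also have "{n \<in> {n. n \<in> A \<and> u dvd n}. d dvd n} = {n \<in> A. lcm u d dvd n}"
      by auto
    also have "real (card \<dots>) \<le> Y / real (lcm u d)"
    proof (rule count)
      show "lcm u d > 0" using u d by (simp add: lcm_pos_nat)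
      have "lcm u d \<le> u * d" using u d by (intro dvd_imp_le) auto
      then have "real (lcm u d) \<le> real u * real d" by (metis of_nat_le_iff of_nat_mult)
      also have "\<dots> \<le> real u * z" using d by (intro mult_left_mono) auto
      finally show "real (lcm u d) \<le> real u * z" .
    qed
    also have "Y / real (lcm u d) = Y / real u * (real (gcd u d) / real d)"
    proof -
      have "real (gcd u d) * real (lcm u d) = real u * real d"
        by (metis of_nat_mult prod_gcd_lcm_nat)
      moreover have "lcm u d > 0" using u d by (simp add: lcm_pos_nat)
      ultimately show ?thesis using u d by (simp add: field_simps)
    qed
    finally show "(\<Sum>n | n \<in> A \<and> u dvd n. if d dvd n then 1 else 0) \<le> Y / real u * (real (gcd u d) / real d)" .
  qed
  also have "\<dots> = Y / real u * (\<Sum>d\<in>?D. real (gcd u d) / real d)"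
    by (simp add: sum_distrib_left)
  also have "\<dots> \<le> Y / real u * (real (divisor_count u) * coprime_harmonic q z)"
    using Y sum_gcd_over_le[OF u] by (intro mult_left_mono) auto
  finally show ?thesis by (simp add: mult_ac)
qed

section \<open>The smooth-rough decomposition of the divisor function\<close>

text \<open>The sum of the weights of the divisors of \<open>n\<close> that are at most \<open>z\<close> and have no prime factor above
  \<open>2 ^ M\<close>, a divisor being encoded by its exponents. The cap \<open>z\<close> on the exponents excludes nothing, since
  \<open>k < p ^ k\<close>.\<close>

definition rankin_majorant :: "real \<Rightarrow> nat \<Rightarrow> real \<Rightarrow> nat \<Rightarrow> real" where
  "rankin_majorant \<beta> M z n =
     (\<Sum>f | f \<in> {p. prime p \<and> p \<le> 2 ^ M} \<rightarrow>\<^sub>E {..nat \<lfloor>z\<rfloor>} \<and>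
        (\<Prod>p | prime p \<and> p \<le> 2 ^ M. p ^ f p) dvd n \<and>
        real (\<Prod>p | prime p \<and> p \<le> 2 ^ M. p ^ f p) \<le> z.
      \<Prod>p | prime p \<and> p \<le> 2 ^ M. rankin_weight \<beta> p (f p))"

lemma rankin_majorant_nonneg: "\<beta> \<ge> 0 \<Longrightarrow> rankin_majorant \<beta> M z n \<ge> 0"
  unfolding rankin_majorant_def
  by (intro sum_nonneg prod_nonneg rankin_weight_nonneg) (auto intro: prime_ge_Suc_0_nat)

text \<open>All divisors of \<open>a\<close> are among those entering the majorant, and their
  weights already account for \<open>a powr \<beta>\<close>.\<close>

lemma powr_le_rankin_majorant:
  assumes "a dvd n" "n > 0" "real a \<le> z" "\<And>p. p \<in> prime_factors a \<Longrightarrow> p \<le> 2 ^ M" "\<beta> \<ge> 0"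
  shows "real a powr \<beta> \<le> rankin_majorant \<beta> M z n"
proof -
  let ?A = "{p :: nat. prime p \<and> p \<le> 2 ^ M}"
  let ?L = "nat \<lfloor>z\<rfloor>"
  have a: "a > 0" using assms by (auto intro: Nat.gr0I)
  have "real a powr \<beta> \<le> (\<Sum>f | f \<in> ?A \<rightarrow>\<^sub>E {..?L} \<and> (\<Prod>p\<in>?A. p ^ f p) dvd a.
           \<Prod>p\<in>?A. rankin_weight \<beta> p (f p))"
  proof (rule powr_le_sum_rankin_weight)
    show "prime_factors a \<subseteq> ?A" using assms(4) by auto
    fix p assume p: "p \<in> ?A"
    then have p2: "p \<ge> 2" by (auto dest: prime_ge_2_nat)
    have "multiplicity p a < 2 ^ multiplicity p a" by (rule less_exp)
    also have "\<dots> \<le> p ^ multiplicity p a" using p2 by (rule power_mono) simp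
    also have "\<dots> \<le> a" using a by (intro dvd_imp_le multiplicity_dvd) auto
    finally have "real (multiplicity p a) \<le> z" using assms(3) by linarith
    then show "multiplicity p a \<le> ?L" by (simp add: le_nat_floor)
  qed (use a assms in auto)
  also have "\<dots> \<le> rankin_majorant \<beta> M z n"
    unfolding rankin_majorant_def
  proof (rule sum_mono2)
    have "finite (?A \<rightarrow>\<^sub>E {..?L})" by (intro finite_PiE) auto
    then show "finite {f. f \<in> ?A \<rightarrow>\<^sub>E {..?L} \<and> (\<Prod>p\<in>?A. p ^ f p) dvd n \<and> real (\<Prod>p\<in>?A. p ^ f p) \<le> z}"
      by (rule rev_finite_subset) blast
    show "{f. f \<in> ?A \<rightarrow>\<^sub>E {..?L} \<and> (\<Prod>p\<in>?A. p ^ f p) dvd a} \<subseteq>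
        {f. f \<in> ?A \<rightarrow>\<^sub>E {..?L} \<and> (\<Prod>p\<in>?A. p ^ f p) dvd n \<and> real (\<Prod>p\<in>?A. p ^ f p) \<le> z}"
    proof (intro subsetI CollectI, elim CollectE conjE, intro conjI)
      fix f assume dvd: "(\<Prod>p\<in>?A. p ^ f p) dvd a"
      then show "(\<Prod>p\<in>?A. p ^ f p) dvd n" using assms(1) by (rule dvd_trans)
      have "real (\<Prod>p\<in>?A. p ^ f p) \<le> real a"
        using dvd a by (intro of_nat_mono dvd_imp_le)
      then show "real (\<Prod>p\<in>?A. p ^ f p) \<le> z" using assms(3) by linarith
    qed
    show "0 \<le> (\<Prod>p\<in>?A. rankin_weight \<beta> p (f p))" for f
      using assms(5) by (intro prod_nonneg rankin_weight_nonneg) (auto intro: prime_ge_Suc_0_nat)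
  qed
  finally show ?thesis .
qed

text \<open>The divisors in the majorant and those counted by \<open>tau_le z\<close> are both at
  most \<open>z\<close>, so only counts of multiples of integers up to \<open>z\<^sup>2\<close> are
  used. Bounding the divisor count of \<open>U f\<close> by the product of the
  \<open>f p + 1\<close> makes each summand multiplicative.\<close>

lemma sum_tau_le_rankin_majorant_le:
  fixes z Y :: real
  assumes A: "finite A" "\<And>n. n \<in> A \<Longrightarrow> coprime n q" and Y: "Y \<ge> 0" and z: "z \<ge> 0"
    and count: "\<And>l. l > 0 \<Longrightarrow> real l \<le> z\<^sup>2 \<Longrightarrow> real (card {n \<in> A. l dvd n}) \<le> Y / real l"
    and \<beta>: "0 \<le> \<beta>" "\<beta> \<le> 1/4" and B: "\<beta> * real M \<le> B"
  shows "(\<Sum>n\<in>A. real (tau_le z n) * rankin_majorant \<beta> M z n)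
           \<le> Y * coprime_harmonic q z * exp (9 * 2 powr B * B * ln 4)"
proof -
  let ?P = "{p :: nat. prime p \<and> p \<le> 2 ^ M}"
  let ?L = "nat \<lfloor>z\<rfloor>"
  define U where "U = (\<lambda>f. \<Prod>p\<in>?P. p ^ f p)"
  define G where "G = (\<lambda>f. \<Prod>p\<in>?P. rankin_weight \<beta> p (f p))"
  define F where "F = {f. f \<in> ?P \<rightarrow>\<^sub>E {..?L} \<and> real (U f) \<le> z}"
  have finPE: "finite (?P \<rightarrow>\<^sub>E {..?L})" by (intro finite_PiE) auto
  have finF: "finite F" unfolding F_def by (rule rev_finite_subset[OF finPE]) blast
  have G0: "G f \<ge> 0" for f
    unfolding G_def using \<beta> by (intro prod_nonneg rankin_weight_nonneg) (auto intro: prime_ge_Suc_0_nat)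
  have U0: "U f > 0" for f
    unfolding U_def by (intro prod_pos) (auto intro: prime_gt_0_nat)
  have H0: "coprime_harmonic q z \<ge> 0" by (rule coprime_harmonic_nonneg)
  have maj: "rankin_majorant \<beta> M z n = (\<Sum>f\<in>F. if U f dvd n then G f else 0)" for n
  proof -
    have "rankin_majorant \<beta> M z n = sum G {f \<in> F. U f dvd n}"
      unfolding rankin_majorant_def G_def F_def U_def by (rule sum.cong) auto
    also have "\<dots> = (\<Sum>f\<in>F. if U f dvd n then G f else 0)"
      by (rule sum.inter_filter[OF finF])
    finally show ?thesis .
  qed
  have "(\<Sum>n\<in>A. real (tau_le z n) * rankin_majorant \<beta> M z n)
      = (\<Sum>n\<in>A. \<Sum>f\<in>F. if U f dvd n then real (tau_le z n) * G f else 0)"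
    unfolding maj sum_distrib_left by (intro sum.cong refl) auto
  also have "\<dots> = (\<Sum>f\<in>F. \<Sum>n\<in>A. if U f dvd n then real (tau_le z n) * G f else 0)"
    by (rule sum.swap)
  also have "\<dots> = (\<Sum>f\<in>F. G f * (\<Sum>n | n \<in> A \<and> U f dvd n. real (tau_le z n)))"
  proof (rule sum.cong[OF refl])
    fix f
    have "(\<Sum>n\<in>A. if U f dvd n then real (tau_le z n) * G f else 0)
        = (\<Sum>n | n \<in> A \<and> U f dvd n. real (tau_le z n) * G f)"
      by (rule sum.inter_filter[OF A(1), symmetric])
    then show "(\<Sum>n\<in>A. if U f dvd n then real (tau_le z n) * G f else 0)
        = G f * (\<Sum>n | n \<in> A \<and> U f dvd n. real (tau_le z n))"
      by (simp add: sum_distrib_left mult.commute)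
  qed
  also have "\<dots> \<le> (\<Sum>f\<in>F. G f * (Y * coprime_harmonic q z * (real (divisor_count (U f)) / real (U f))))"
  proof (intro sum_mono mult_left_mono G0)
    fix f assume f: "f \<in> F"
    show "(\<Sum>n | n \<in> A \<and> U f dvd n. real (tau_le z n))
        \<le> Y * coprime_harmonic q z * (real (divisor_count (U f)) / real (U f))"
    proof (rule sum_tau_le_multiples_le)
      fix l :: nat assume l: "l > 0" "real l \<le> real (U f) * z"
      have "real (U f) * z \<le> z * z" using f z by (intro mult_right_mono) (auto simp: F_def)
      with l show "real (card {n \<in> A. l dvd n}) \<le> Y / real l"
        by (intro count) (auto simp: power2_eq_square)
    qed (use A Y U0 in auto)
  qed
  also have "\<dots> \<le> (\<Sum>f\<in>F. Y * coprime_harmonic q z *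
      (\<Prod>p\<in>?P. rankin_weight \<beta> p (f p) * (real (f p) + 1) / real p ^ f p))"
  proof (rule sum_mono)
    fix f assume "f \<in> F"
    have "divisor_count (U f) \<le> (\<Prod>p\<in>?P. f p + 1)"
      unfolding U_def by (rule divisor_count_prod_prime_powers_le) auto
    then have "real (divisor_count (U f)) \<le> real (\<Prod>p\<in>?P. f p + 1)"
      by (subst of_nat_le_iff)
    also have "\<dots> = (\<Prod>p\<in>?P. real (f p) + 1)"
      by (simp add: add.commute)
    finally have dc: "real (divisor_count (U f)) \<le> (\<Prod>p\<in>?P. real (f p) + 1)" .
    have "G f * (Y * coprime_harmonic q z * (real (divisor_count (U f)) / real (U f)))
        = Y * coprime_harmonic q z * (G f * real (divisor_count (U f)) / real (U f))"
      by simp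
    also have "\<dots> \<le> Y * coprime_harmonic q z * (G f * (\<Prod>p\<in>?P. real (f p) + 1) / real (U f))"
      using dc G0 Y H0 by (intro mult_left_mono divide_right_mono mult_nonneg_nonneg) auto
    also have "G f * (\<Prod>p\<in>?P. real (f p) + 1) / real (U f)
        = (\<Prod>p\<in>?P. rankin_weight \<beta> p (f p) * (real (f p) + 1) / real p ^ f p)"
      by (simp add: G_def U_def prod_dividef prod.distrib)
    finally show "G f * (Y * coprime_harmonic q z * (real (divisor_count (U f)) / real (U f)))
        \<le> Y * coprime_harmonic q z *
          (\<Prod>p\<in>?P. rankin_weight \<beta> p (f p) * (real (f p) + 1) / real p ^ f p)" .
  qed
  also have "\<dots> = Y * coprime_harmonic q z *
      (\<Sum>f\<in>F. \<Prod>p\<in>?P. rankin_weight \<beta> p (f p) * (real (f p) + 1) / real p ^ f p)"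
    by (simp add: sum_distrib_left)
  \<comment> \<open>Dropping the cap \<open>U f \<le> z\<close> adds nonnegative terms and makes the
    range a full box, over which the sum factors into an Euler product.\<close>
  also have "(\<Sum>f\<in>F. \<Prod>p\<in>?P. rankin_weight \<beta> p (f p) * (real (f p) + 1) / real p ^ f p)
      \<le> (\<Sum>f\<in>?P \<rightarrow>\<^sub>E {..?L}. \<Prod>p\<in>?P. rankin_weight \<beta> p (f p) * (real (f p) + 1) / real p ^ f p)"
  proof (rule sum_mono2[OF finPE])
    show "F \<subseteq> ?P \<rightarrow>\<^sub>E {..?L}" unfolding F_def by blast
    show "0 \<le> (\<Prod>p\<in>?P. rankin_weight \<beta> p (f p) * (real (f p) + 1) / real p ^ f p)" for f
      using \<beta> by (intro prod_nonneg divide_nonneg_nonneg mult_nonneg_nonneg rankin_weight_nonneg)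
        (auto intro: prime_ge_Suc_0_nat)
  qed
  also have "\<dots> = (\<Prod>p\<in>?P. \<Sum>k\<le>?L. rankin_weight \<beta> p k * (real k + 1) / real p ^ k)"
    by (rule prod_sum_PiE[symmetric]) auto
  also have "\<dots> \<le> exp (9 * 2 powr B * B * ln 4)"
    by (rule rankin_euler_product_le) fact+
  finally show ?thesis using Y H0 by (simp add: mult_left_mono)
qed

section \<open>Pointwise comparison of the full and the truncated divisor function\<close>

lemma double_exponential_scale:
  fixes P :: nat
  assumes "P \<ge> 2"
  obtains i where "2 ^ (2 ^ i) \<le> P" "P < 2 ^ (2 ^ Suc i)"
proof -
  define j where "j = (LEAST j. P < 2 ^ (2 ^ j))"
  have "P < 2 ^ P" by (rule less_exp)
  also have "\<dots> \<le> 2 ^ (2 ^ P)" using less_exp[of P] by (intro power_increasing) auto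
  finally have j: "P < 2 ^ (2 ^ j)" unfolding j_def by (rule LeastI)
  then have "j \<noteq> 0" using assms by (intro notI) simp
  then obtain i where i: "j = Suc i" by (cases j) auto
  have "\<not> P < 2 ^ (2 ^ i)" using not_less_Least[of i "\<lambda>j. P < 2 ^ (2 ^ j)"] i by (simp add: j_def)
  then show thesis using that[of i] j i by simp
qed

text \<open>As \<open>b \<le> z powr K\<close> is rough at scale \<open>i\<close>, its divisor count
  is \<open>O(z powr (\<beta> i / 4))\<close>. For \<open>P \<le> sqrt z\<close> the majorant is at
  least \<open>z powr (\<beta> i / 2)\<close>, twice the exponent required, which leaves the saving
  \<open>z powr (- (\<beta> i / 4))\<close> in front of it. The scale depends on \<open>n\<close>,
  hence the sum over all scales.\<close>

lemma divisor_count_le_rankin_majorant: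
  fixes K :: real
  assumes K: "K \<ge> 1"
  defines "\<beta> \<equiv> \<lambda>i. min (1/4) (4 * K / 2 ^ i)"
  shows "\<exists>C \<ge> 1. \<forall>z n. z \<ge> 2 \<and> n > 0 \<and> real n \<le> z powr K \<longrightarrow>
    real (divisor_count n) \<le> C * real (tau_le z n) *
      (1 + (\<Sum>i | 2 ^ (2 ^ i) \<le> sqrt z. z powr (- (\<beta> i / 4)) * rankin_majorant (\<beta> i) (2 ^ Suc i) z n))"
proof -
  \<comment> \<open>Chosen so that \<open>K * min \<xi> (1 / 2 ^ i)\<close> is exactly
    \<open>\<beta> i / 4\<close>.\<close>
  define \<xi> where "\<xi> = 1 / (16 * K)"
  have \<xi>: "0 < \<xi>" "\<xi> \<le> 1" using K by (auto simp: \<xi>_def)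
  obtain C where C: "C \<ge> 1" and rough: "\<And>i b. b > 0 \<Longrightarrow> (\<And>p. p \<in> prime_factors b \<Longrightarrow> 2 ^ (2 ^ i) \<le> p) \<Longrightarrow>
           real (divisor_count b) \<le> C * real b powr (min \<xi> (1 / 2 ^ i))"
    using divisor_count_rough_bound[OF \<xi>] by blast
  have \<beta>0: "\<beta> i > 0" for i using K by (simp add: \<beta>_def)
  have K16: "16 powr K \<ge> 1" using K by (simp add: ge_one_powr_ge_zero)
  have "real (divisor_count n) \<le> C * 16 powr K * real (tau_le z n) *
      (1 + (\<Sum>i | 2 ^ (2 ^ i) \<le> sqrt z. z powr (- (\<beta> i / 4)) * rankin_majorant (\<beta> i) (2 ^ Suc i) z n))"
    if z: "z \<ge> 2" and n: "n > 0" and nz: "real n \<le> z powr K" for z n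
  proof -
    let ?I = "{i :: nat. 2 ^ (2 ^ i) \<le> sqrt z}"
    let ?R = "\<lambda>i. z powr (- (\<beta> i / 4)) * rankin_majorant (\<beta> i) (2 ^ Suc i) z n"
    have R0: "?R i \<ge> 0" for i using \<beta>0[of i] rankin_majorant_nonneg[of "\<beta> i"] by simp
    have finI: "finite ?I"
    proof (rule finite_subset)
      show "?I \<subseteq> {..nat \<lfloor>sqrt z\<rfloor>}"
      proof
        fix i assume "i \<in> ?I"
        then have "real (2 ^ (2 ^ i)) \<le> sqrt z" by simp
        moreover have "i < 2 ^ i" "(2 :: nat) ^ i < 2 ^ (2 ^ i)" by (rule less_exp)+
        then have "i \<le> 2 ^ (2 ^ i)" by linarith
        then have "real i \<le> real (2 ^ (2 ^ i))" by (subst of_nat_le_iff)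
        ultimately have "real i \<le> sqrt z" by linarith
        then show "i \<in> {..nat \<lfloor>sqrt z\<rfloor>}" by (simp add: le_nat_floor)
      qed
    qed simp
    have sum0: "sum ?R ?I \<ge> 0" by (rule sum_nonneg) (rule R0)
    obtain a b where ab: "n = a * b" "real a \<le> z" and split: "b = 1 \<or> (\<exists>P. prime P \<and> real a * real P > z \<and>
        (\<forall>p \<in> prime_factors a. p \<le> P) \<and> (\<forall>p \<in> prime_factors b. P \<le> p))"
      by (rule smooth_rough_split[of n z]) (use n z in auto)
    have pos: "a > 0" "b > 0" using n ab by auto
    have "{d. d dvd a} \<subseteq> {d. d > 0 \<and> real d \<le> z \<and> d dvd n}"
    proof clarify
      fix d assume d: "d dvd a"
      have "real d \<le> real a" using d pos by (intro of_nat_mono dvd_imp_le)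
      then show "d > 0 \<and> real d \<le> z \<and> d dvd n"
        using d pos ab by (auto intro: Nat.gr0I)
    qed
    then have ta: "divisor_count a \<le> tau_le z n"
      unfolding divisor_count_def tau_le_def by (intro card_mono finite_real_le_nat)
    have "divisor_count n \<le> divisor_count a * divisor_count b"
      using divisor_count_mult_le[OF pos] ab by simp
    also have "\<dots> \<le> tau_le z n * divisor_count b" using ta by (rule mult_right_mono) simp
    finally have "real (divisor_count n) \<le> real (tau_le z n * divisor_count b)" by (subst of_nat_le_iff)
    then have main: "real (divisor_count n) \<le> real (tau_le z n) * real (divisor_count b)" by simp
    have "real (divisor_count b) \<le> C * 16 powr K * (1 + sum ?R ?I)"
    proof (cases "b = 1")
      case True
      have "1 * 1 * 1 \<le> C * 16 powr K * (1 + sum ?R ?I)"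
        using C K16 sum0 by (intro mult_mono) auto
      then show ?thesis using True by simp
    next
      case False
      with split obtain P where P: "prime P" "real a * real P > z"
        "\<And>p. p \<in> prime_factors a \<Longrightarrow> p \<le> P" "\<And>p. p \<in> prime_factors b \<Longrightarrow> P \<le> p" by blast
      obtain i where i: "2 ^ (2 ^ i) \<le> P" "P < 2 ^ (2 ^ Suc i)"
        using double_exponential_scale[OF prime_ge_2_nat[OF P(1)]] by blast
      have "real (divisor_count b) \<le> C * real b powr (min \<xi> (1 / 2 ^ i))"
        using pos i P(4) by (intro rough) (auto intro: order_trans)
      also have "\<dots> \<le> C * (z powr K) powr (min \<xi> (1 / 2 ^ i))"
      proof -
        have "b \<le> n" using ab pos by simp
        then have "real b \<le> z powr K" using nz by linarith
        then show ?thesis using C \<xi> by (intro mult_left_mono powr_mono2) auto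
      qed
      also have "(z powr K) powr (min \<xi> (1 / 2 ^ i)) = z powr (\<beta> i / 4)"
      proof -
        have "K * min \<xi> (1 / 2 ^ i) = min (K * \<xi>) (K * (1 / 2 ^ i))"
          using K by (simp add: min_mult_distrib_left)
        also have "\<dots> = min (1 / 16) (K / 2 ^ i)" using K by (simp add: \<xi>_def)
        also have "\<dots> = \<beta> i / 4" by (auto simp: \<beta>_def min_def field_simps)
        finally show ?thesis by (simp only: powr_powr)
      qed
      finally have b1: "real (divisor_count b) \<le> C * z powr (\<beta> i / 4)" .
      have "z powr (\<beta> i / 4) \<le> 16 powr K * (1 + sum ?R ?I)"
      proof (cases "real P \<le> sqrt z")
        case True
        have "real (2 ^ (2 ^ i)) \<le> real P" using i by (subst of_nat_le_iff)
        then have "real (2 ^ (2 ^ i)) \<le> sqrt z" using True by (rule order_trans)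
        then have iI: "i \<in> ?I" by simp
        have P0: "real P > 0" using prime_gt_0_nat[OF P(1)] by simp
        have "z < real a * real P" by (rule P(2))
        also have "\<dots> \<le> real a * sqrt z" using True by (intro mult_left_mono) auto
        finally have "sqrt z * sqrt z < real a * sqrt z" using z by simp
        then have "sqrt z \<le> real a" using z by (intro less_imp_le) (erule mult_right_less_imp_less, simp)
        then have "sqrt z powr \<beta> i \<le> real a powr \<beta> i"
          using \<beta>0[of i] z by (intro powr_mono2) auto
        also have "\<dots> \<le> rankin_majorant (\<beta> i) (2 ^ Suc i) z n"
          using ab n P(3) i(2) \<beta>0[of i] by (intro powr_le_rankin_majorant) (auto intro: order_trans less_imp_le)
        also have "sqrt z powr \<beta> i = z powr (\<beta> i / 2)"
          using z by (simp add: powr_half_sqrt[symmetric] powr_powr)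
        finally have "z powr (- (\<beta> i / 4)) * z powr (\<beta> i / 2) \<le> ?R i"
          by (intro mult_left_mono) auto
        also have "z powr (- (\<beta> i / 4)) * z powr (\<beta> i / 2) = z powr (\<beta> i / 4)"
          by (simp flip: powr_add)
        also have "?R i \<le> sum ?R ?I" using iI finI R0 by (intro member_le_sum) auto
        also have "\<dots> \<le> 1 * (1 + sum ?R ?I)" by simp
        also have "\<dots> \<le> 16 powr K * (1 + sum ?R ?I)" using K16 sum0 by (intro mult_right_mono) auto
        finally show ?thesis .
      next
        \<comment> \<open>Now \<open>z\<close> is at most \<open>2 powr (4 * 2 ^ i)\<close>, so
          \<open>z powr (\<beta> i / 4)\<close> is bounded by \<open>16 powr K\<close>; the summand
          1 in the bound accounts for this case.\<close>
        case False
        have "real P < real (2 ^ (2 ^ Suc i))" using i by (subst of_nat_less_iff)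
        then have "sqrt z \<le> real (2 ^ (2 ^ Suc i))" using False by linarith
        then have "sqrt z \<le> 2 ^ (2 ^ Suc i)" by simp
        then have "(sqrt z)\<^sup>2 \<le> (2 ^ (2 ^ Suc i))\<^sup>2" using z by (intro power_mono) auto
        moreover have "((2 :: real) ^ (2 ^ Suc i))\<^sup>2 = 2 powr real (4 * 2 ^ i)"
          by (subst powr_realpow) (simp_all flip: power_mult)
        ultimately have z4: "z \<le> 2 powr (4 * 2 ^ i)" using z by simp
        have "z powr (\<beta> i / 4) \<le> z powr (K / 2 ^ i)"
          using z by (intro powr_mono) (auto simp: \<beta>_def min_def mult.commute)
        also have "\<dots> \<le> (2 powr (4 * 2 ^ i)) powr (K / 2 ^ i)"
          using z4 z K by (intro powr_mono2) auto
        also have "\<dots> = 2 powr (4 * K)" by (simp add: powr_powr)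
        also have "\<dots> = (2 powr 4) powr K" by (simp only: powr_powr)
        also have "(2 powr 4 :: real) = 16" by simp
        also have "16 powr K * 1 \<le> 16 powr K * (1 + sum ?R ?I)"
          using sum0 by (intro mult_left_mono) auto
        finally show ?thesis by simp
      qed
      then have "C * z powr (\<beta> i / 4) \<le> C * (16 powr K * (1 + sum ?R ?I))"
        using C by (intro mult_left_mono) auto
      with b1 show ?thesis by (simp add: mult_ac)
    qed
    then have "real (tau_le z n) * real (divisor_count b) \<le> real (tau_le z n) * (C * 16 powr K * (1 + sum ?R ?I))"
      by (intro mult_left_mono) auto
    with main show ?thesis by (simp add: mult_ac)
  qed
  moreover have "C * 16 powr K \<ge> 1 * 1" using C K16 by (intro mult_mono) auto
  ultimately show ?thesis by (intro exI[of _ "C * 16 powr K"]) auto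
qed

section \<open>Divisor sums over arithmetic progressions\<close>

lemma sum_powers_of_2_le:
  fixes M :: real
  assumes "\<And>i. i \<in> I \<Longrightarrow> 2 ^ i \<le> M" "finite I" "M \<ge> 0"
  shows "(\<Sum>i\<in>I. 2 ^ i :: real) \<le> 2 * M"
proof (cases "I = {}")
  case False
  have "(\<Sum>i\<in>I. 2 ^ i :: real) \<le> (\<Sum>i<Suc (Max I). 2 ^ i)"
    using assms by (intro sum_mono2) (auto simp: less_Suc_eq_le)
  also have "\<dots> = 2 * 2 ^ Max I - 1" by (subst geometric_sum) auto
  also have "\<dots> \<le> 2 * M" using assms(1)[OF Max_in[OF assms(2) False]] by linarith
  finally show ?thesis .
qed (use assms in simp)

text \<open>The exponent \<open>min (1/4) (4 * K / 2 ^ i)\<close> is at least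
  \<open>1 / (4 * 2 ^ i)\<close>, so each term is at most \<open>exp (- v) \<le> 1 / v\<close> with
  \<open>v = ln z / (16 * 2 ^ i)\<close>. On this range \<open>2 ^ i \<le> ln z\<close>, so the
  powers of 2 sum to at most \<open>2 * ln z\<close> and the logarithm cancels.\<close>

lemma sum_scale_savings_le:
  fixes K z :: real
  assumes K: "K \<ge> 1" and z: "z \<ge> 2"
  shows "finite {i :: nat. 2 ^ (2 ^ i) \<le> sqrt z}"
    and "(\<Sum>i | 2 ^ (2 ^ i) \<le> sqrt z. z powr (- (min (1/4) (4 * K / 2 ^ i) / 4))) \<le> 32"
proof -
  let ?I = "{i :: nat. 2 ^ (2 ^ i) \<le> sqrt z}"
  have lnz: "ln z > 0" using z by simp
  have ln2: "ln 2 \<ge> (1/2 :: real)"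
    using ln_le_minus_one[of "1/2 :: real"] by (simp add: ln_div)
  have le: "2 ^ i \<le> ln z" if "i \<in> ?I" for i
  proof -
    have "ln ((2 :: real) ^ (2 ^ i)) \<le> ln (sqrt z)" using that z by (intro ln_mono) auto
    then have "2 ^ i * ln 2 \<le> ln z / 2" using z by (simp add: ln_realpow ln_sqrt)
    moreover have "2 ^ i * (1/2) \<le> 2 ^ i * ln (2 :: real)" using ln2 by (intro mult_left_mono) auto
    ultimately show ?thesis by linarith
  qed
  show fin: "finite ?I"
  proof (rule finite_subset)
    show "?I \<subseteq> {..nat \<lfloor>ln z\<rfloor>}"
    proof
      fix i assume "i \<in> ?I"
      then have "2 ^ i \<le> ln z" by (rule le)
      moreover have "real i < 2 ^ i" by (rule of_nat_less_two_power)
      ultimately have "real i \<le> ln z" by linarith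
      then show "i \<in> {..nat \<lfloor>ln z\<rfloor>}" by (simp add: le_nat_floor)
    qed
  qed simp
  have "(\<Sum>i\<in>?I. z powr (- (min (1/4) (4 * K / 2 ^ i) / 4))) \<le> (\<Sum>i\<in>?I. 16 / ln z * 2 ^ i)"
  proof (rule sum_mono)
    fix i
    define v where "v = ln z / (16 * 2 ^ i)"
    have v: "v > 0" using lnz by (simp add: v_def)
    have "1 / (4 * 2 ^ i) \<le> min (1/4) (4 * K / 2 ^ i)"
      using K by (auto simp: field_simps)
    then have "z powr (- (min (1/4) (4 * K / 2 ^ i) / 4)) \<le> z powr (- (1 / (4 * 2 ^ i) / 4))"
      using z by (intro powr_mono) auto
    also have "\<dots> = exp (- v)" using z by (simp add: powr_def v_def)
    also have "\<dots> \<le> 1 / v"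
    proof -
      have "v \<le> exp v" using exp_ge_add_one_self[of v] by linarith
      then show ?thesis using v by (simp add: exp_minus inverse_eq_divide frac_le)
    qed
    also have "\<dots> = 16 / ln z * 2 ^ i" by (simp add: v_def)
    finally show "z powr (- (min (1/4) (4 * K / 2 ^ i) / 4)) \<le> 16 / ln z * 2 ^ i" .
  qed
  also have "\<dots> = 16 / ln z * (\<Sum>i\<in>?I. 2 ^ i)" by (simp add: sum_distrib_left)
  also have "\<dots> \<le> 16 / ln z * (2 * ln z)"
    using fin lnz le by (intro mult_left_mono sum_powers_of_2_le) auto
  also have "\<dots> = 32" using lnz by simp
  finally show "(\<Sum>i\<in>?I. z powr (- (min (1/4) (4 * K / 2 ^ i) / 4))) \<le> 32" .
qed

text \<open>When the pointwise bound is summed over \<open>A\<close>, every scale costs the same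
  factor \<open>E\<close> and the savings add up to at most 32. The progression enters only through
  coprimality to \<open>q\<close> and the counts of multiples up to
  \<open>z\<^sup>2\<close>.\<close>

lemma sum_divisor_count_le:
  fixes K :: real
  assumes K: "K \<ge> 1"
  obtains C :: real where "C \<ge> 1" and "\<And>(z :: real) Y q A. z \<ge> 2 \<Longrightarrow> Y \<ge> 0 \<Longrightarrow> finite A \<Longrightarrow>
    (\<And>n. n \<in> A \<Longrightarrow> n > 0) \<Longrightarrow> (\<And>n. n \<in> A \<Longrightarrow> real n \<le> z powr K) \<Longrightarrow> (\<And>n. n \<in> A \<Longrightarrow> coprime n q) \<Longrightarrow>
    (\<And>l. l > 0 \<Longrightarrow> real l \<le> z\<^sup>2 \<Longrightarrow> real (card {n \<in> A. l dvd n}) \<le> Y / real l) \<Longrightarrow>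
      (\<Sum>n\<in>A. real (divisor_count n)) \<le> C * Y * coprime_harmonic q z"
proof -
  define \<beta> where "\<beta> = (\<lambda>i. min (1/4) (4 * K / 2 ^ i))"
  have \<beta>: "\<beta> i \<ge> 0" "\<beta> i \<le> 1/4" for i using K by (auto simp: \<beta>_def)
  obtain C where C: "C \<ge> 1" and pointwise: "\<And>z n. z \<ge> 2 \<Longrightarrow> n > 0 \<Longrightarrow> real n \<le> z powr K \<Longrightarrow>
    real (divisor_count n) \<le> C * real (tau_le z n) *
      (1 + (\<Sum>i | 2 ^ (2 ^ i) \<le> sqrt z. z powr (- (\<beta> i / 4)) * rankin_majorant (\<beta> i) (2 ^ Suc i) z n))"
    using divisor_count_le_rankin_majorant[OF K] unfolding \<beta>_def by blast
  \<comment> \<open>A bound for \<open>\<beta> i * 2 ^ Suc i\<close> that is uniform in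
    \<open>i\<close>, since \<open>\<beta> i \<le> 4 * K / 2 ^ i\<close>.\<close>
  define B where "B = 8 * K"
  define E where "E = exp (9 * 2 powr B * B * ln 4)"
  have bound: "(\<Sum>n\<in>A. real (divisor_count n)) \<le> C * (1 + 32 * E) * Y * coprime_harmonic q z"
    if z: "z \<ge> 2" and Y: "Y \<ge> 0" and A: "finite A"
      "\<And>n. n \<in> A \<Longrightarrow> n > 0" "\<And>n. n \<in> A \<Longrightarrow> real n \<le> z powr K" "\<And>n. n \<in> A \<Longrightarrow> coprime n q"
      and count: "\<And>l. l > 0 \<Longrightarrow> real l \<le> z\<^sup>2 \<Longrightarrow> real (card {n \<in> A. l dvd n}) \<le> Y / real l"
    for z Y q A
  proof -
    let ?I = "{i :: nat. 2 ^ (2 ^ i) \<le> sqrt z}"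
    let ?H = "coprime_harmonic q z"
    let ?s = "\<lambda>i. z powr (- (\<beta> i / 4))"
    let ?R = "\<lambda>i n. rankin_majorant (\<beta> i) (2 ^ Suc i) z n"
    have fin: "finite ?I" using K z by (rule sum_scale_savings_le)
    have H0: "?H \<ge> 0" by (rule coprime_harmonic_nonneg)
    have base: "(\<Sum>n\<in>A. real (tau_le z n)) \<le> Y * ?H"
    proof -
      have "(\<Sum>n | n \<in> A \<and> 1 dvd n. real (tau_le z n)) \<le> Y * ?H * (real (divisor_count 1) / real 1)"
      proof (rule sum_tau_le_multiples_le)
        fix l :: nat assume l: "l > 0" "real l \<le> real 1 * z"
        have "z * 1 \<le> z * z" using z by (intro mult_left_mono) auto
        with l have "real l \<le> z\<^sup>2" unfolding power2_eq_square by linarith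
        with l show "real (card {n \<in> A. l dvd n}) \<le> Y / real l" by (intro count)
      qed (use A Y in auto)
      then show ?thesis by simp
    qed
    have class_i: "(\<Sum>n\<in>A. real (tau_le z n) * ?R i n) \<le> Y * ?H * E" for i
      unfolding E_def
    proof (rule sum_tau_le_rankin_majorant_le)
      have "\<beta> i * real (2 ^ Suc i) \<le> 4 * K / 2 ^ i * real (2 ^ Suc i)"
        by (intro mult_right_mono) (auto simp: \<beta>_def)
      then show "\<beta> i * real (2 ^ Suc i) \<le> B" by (simp add: B_def)
    qed (use A Y z count \<beta> in auto)
    have "(\<Sum>n\<in>A. real (divisor_count n)) \<le> (\<Sum>n\<in>A. C * real (tau_le z n) * (1 + (\<Sum>i\<in>?I. ?s i * ?R i n)))"
      using A z by (intro sum_mono pointwise) auto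
    also have "\<dots> = C * ((\<Sum>n\<in>A. real (tau_le z n)) + (\<Sum>n\<in>A. \<Sum>i\<in>?I. ?s i * (real (tau_le z n) * ?R i n)))"
      by (simp add: sum_distrib_left sum.distrib distrib_left mult_ac)
    also have "(\<Sum>n\<in>A. \<Sum>i\<in>?I. ?s i * (real (tau_le z n) * ?R i n))
        = (\<Sum>i\<in>?I. ?s i * (\<Sum>n\<in>A. real (tau_le z n) * ?R i n))"
      by (subst sum.swap) (simp add: sum_distrib_left)
    also have "C * ((\<Sum>n\<in>A. real (tau_le z n)) + (\<Sum>i\<in>?I. ?s i * (\<Sum>n\<in>A. real (tau_le z n) * ?R i n)))
        \<le> C * (Y * ?H + (\<Sum>i\<in>?I. ?s i * (Y * ?H * E)))"
      using C base class_i by (intro mult_left_mono add_mono sum_mono) auto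
    also have "\<dots> = C * (Y * ?H + (\<Sum>i\<in>?I. ?s i) * (Y * ?H * E))"
      by (simp add: sum_distrib_right)
    also have "\<dots> \<le> C * (Y * ?H + 32 * (Y * ?H * E))"
      using C Y H0 sum_scale_savings_le(2)[OF K z]
      by (intro mult_left_mono add_left_mono mult_right_mono) (auto simp: \<beta>_def E_def)
    finally show ?thesis by (simp add: algebra_simps)
  qed
  have "C * (1 + 32 * E) \<ge> 1 * 1" using C by (intro mult_mono) (auto simp: E_def)
  then show thesis by (intro that[of "C * (1 + 32 * E)"] bound) simp_all
qed

lemma tau_le_le_divisor_count: "n > 0 \<Longrightarrow> tau_le N n \<le> divisor_count n"
  unfolding tau_le_def divisor_count_def by (intro card_mono) auto

text \<open>The free left endpoint \<open>w\<close> lets both sums of the theorem be instances. In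
  each case \<open>ln q\<close> has to be absorbed into \<open>ln N\<close>: for
  \<open>N \<le> z\<close> by \<open>N \<ge> q powr \<kappa>\<close>, for \<open>N > z\<close> by
  \<open>q \<le> z powr K\<close>.\<close>

lemma sum_tau_le_progression_le:
  fixes K \<kappa> :: real
  assumes K: "K \<ge> 1" and \<kappa>: "\<kappa> > 0"
  obtains C :: real where "C > 0" and "\<And>(z :: real) (N :: real) (q :: nat) (r :: int) (w :: real) (y :: real).
    z \<ge> 2 \<Longrightarrow> N \<ge> 2 \<Longrightarrow> q > 0 \<Longrightarrow> N \<ge> real q powr \<kappa> \<Longrightarrow> coprime r (int q) \<Longrightarrow> y \<ge> 0 \<Longrightarrow>
    z\<^sup>2 * real q \<le> y \<Longrightarrow> w + y \<le> z powr K \<Longrightarrow> real q \<le> z powr K \<Longrightarrow>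
      (\<Sum>n | n > 0 \<and> w < real n \<and> real n \<le> w + y \<and> [int n = r] (mod int q). real (tau_le N n))
        \<le> C * (y * real (totient q) * ln N / (real q)\<^sup>2)"
proof (rule sum_divisor_count_le[OF K])
  fix C1 :: real
  assume C1: "C1 \<ge> 1" and divsum: "\<And>(z :: real) Y q A. z \<ge> 2 \<Longrightarrow> Y \<ge> 0 \<Longrightarrow> finite A \<Longrightarrow>
    (\<And>n. n \<in> A \<Longrightarrow> n > 0) \<Longrightarrow> (\<And>n. n \<in> A \<Longrightarrow> real n \<le> z powr K) \<Longrightarrow> (\<And>n. n \<in> A \<Longrightarrow> coprime n q) \<Longrightarrow>
    (\<And>l. l > 0 \<Longrightarrow> real l \<le> z\<^sup>2 \<Longrightarrow> real (card {n \<in> A. l dvd n}) \<le> Y / real l) \<Longrightarrow>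
      (\<Sum>n\<in>A. real (divisor_count n)) \<le> C1 * Y * coprime_harmonic q z"
  \<comment> \<open>In \<open>1 + ln t + ln q\<close> the 1 costs \<open>2 * ln N\<close>, as
    \<open>ln N \<ge> 1/2\<close>; \<open>ln t\<close> costs \<open>ln N\<close> and
    \<open>ln q\<close> costs \<open>(K + 1 / \<kappa>) * ln N\<close>.\<close>
  define c where "c = 3 + K + 1 / \<kappa>"
  have c0: "c > 0" using K \<kappa> by (simp add: c_def add_pos_pos)
  have bound: "(\<Sum>n | n > 0 \<and> w < real n \<and> real n \<le> w + y \<and> [int n = r] (mod int q). real (tau_le N n))
        \<le> 4 * C1 * c * (y * real (totient q) * ln N / (real q)\<^sup>2)"
    if z: "z \<ge> 2" and N: "N \<ge> 2" and q: "q > 0" and Nq: "N \<ge> real q powr \<kappa>" and r: "coprime r (int q)"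
      and y: "y \<ge> 0" and zy: "z\<^sup>2 * real q \<le> y" and wy: "w + y \<le> z powr K" and qz: "real q \<le> z powr K"
    for z N :: real and q :: nat and r :: int and w y :: real
  proof -
    define A where "A = {n. n > 0 \<and> w < real n \<and> real n \<le> w + y \<and> [int n = r] (mod int q)}"
    define Y where "Y = 2 * y / real q"
    have Y0: "Y \<ge> 0" using y by (simp add: Y_def)
    have finA: "finite A"
      unfolding A_def
      by (rule finite_subset[OF _ finite_real_le_nat[of "w + y" "\<lambda>_. True"]]) auto
    have cop: "coprime n q" if "n \<in> A" for n
    proof -
      have "[int n = r] (mod int q)" using that by (simp add: A_def)
      then have "coprime (int n) (int q)" using r by (meson cong_imp_coprime cong_sym)
      then show ?thesis by simp
    qed
    have count: "real (card {n \<in> A. l dvd n}) \<le> Y / real l" if l: "l > 0" "real l \<le> z\<^sup>2" for l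
    proof -
      have "real (card {n \<in> A. l dvd n}) \<le> y / real (q * l) + 1"
        using card_progression_multiples_le[OF q l(1) y r, of w] by (simp add: A_def conj_assoc)
      \<comment> \<open>For \<open>l \<le> z\<^sup>2\<close> the rounding error is no larger than
        the main term; this explains the factor 2 in \<open>Y\<close>.\<close>
      also have "1 \<le> y / real (q * l)"
      proof -
        have "real l * real q \<le> z\<^sup>2 * real q" using l by (intro mult_right_mono) auto
        also have "\<dots> \<le> y" by (rule zy)
        finally show ?thesis using l q by (simp add: field_simps)
      qed
      finally show ?thesis by (simp add: Y_def mult.commute)
    qed
    have lnN: "ln N \<ge> 1/2"
    proof -
      have "1/2 \<le> ln (2 :: real)"
        using ln_le_minus_one[of "1/2 :: real"] by (simp add: ln_div)
      also have "\<dots> \<le> ln N" using N by simp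
      finally show ?thesis .
    qed
    have harmonic: "coprime_harmonic q t \<le> 2 * (real (totient q) / real q) * (c * ln N)"
      if t: "t \<ge> 1" "t \<le> N" and tq: "ln (real q) \<le> (K + 1 / \<kappa>) * ln N" for t
    proof -
      have "ln (t * real q) = ln t + ln (real q)" using t q by (simp add: ln_mult)
      also have "\<dots> \<le> ln N + (K + 1 / \<kappa>) * ln N" using t tq by (intro add_mono) auto
      finally have *: "1 + ln (t * real q) \<le> c * ln N" using lnN by (simp add: c_def algebra_simps)
      have "coprime_harmonic q t \<le> 2 * (real (totient q) / real q) * (1 + ln (t * real q))"
        using q t by (intro coprime_harmonic_le) auto
      also have "\<dots> \<le> 2 * (real (totient q) / real q) * (c * ln N)"
        using * by (rule mult_left_mono) simp
      finally show ?thesis .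
    qed
    have "(\<Sum>n\<in>A. real (tau_le N n)) \<le> C1 * Y * (2 * (real (totient q) / real q) * (c * ln N))"
    proof (cases "N \<le> z")
      case True
      have "(\<Sum>n | n \<in> A \<and> 1 dvd n. real (tau_le N n))
          \<le> Y * coprime_harmonic q N * (real (divisor_count 1) / real 1)"
      proof (rule sum_tau_le_multiples_le)
        fix l :: nat assume l: "l > 0" "real l \<le> real 1 * N"
        have "z * 1 \<le> z * z" using z by (intro mult_left_mono) auto
        with l True have "real l \<le> z\<^sup>2" unfolding power2_eq_square by linarith
        with l show "real (card {n \<in> A. l dvd n}) \<le> Y / real l" by (intro count)
      qed (use finA cop Y0 in auto)
      also have "Y * coprime_harmonic q N * (real (divisor_count 1) / real 1) = Y * coprime_harmonic q N"
        by simp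
      also have "\<dots> \<le> C1 * Y * coprime_harmonic q N"
        using C1 Y0 mult_right_mono[of 1 C1 "Y * coprime_harmonic q N"] coprime_harmonic_nonneg[of q N] by simp
      also have "\<dots> \<le> C1 * Y * (2 * (real (totient q) / real q) * (c * ln N))"
      proof (intro mult_left_mono harmonic)
        have "\<kappa> * ln (real q) = ln (real q powr \<kappa>)" using q by (simp add: ln_powr)
        also have "\<dots> \<le> ln N" using Nq q by (intro ln_mono) auto
        finally have "ln (real q) \<le> 1 / \<kappa> * ln N" using \<kappa> by (simp add: field_simps)
        also have "\<dots> \<le> (K + 1 / \<kappa>) * ln N" using K lnN by (intro mult_right_mono) auto
        finally show "ln (real q) \<le> (K + 1 / \<kappa>) * ln N" .
      qed (use N C1 Y0 in auto)
      finally show ?thesis by simp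
    next
      case False
      have "(\<Sum>n\<in>A. real (tau_le N n)) \<le> (\<Sum>n\<in>A. real (divisor_count n))"
        by (intro sum_mono of_nat_mono tau_le_le_divisor_count) (auto simp: A_def)
      also have "\<dots> \<le> C1 * Y * coprime_harmonic q z"
      proof (rule divsum[OF z Y0 finA _ _ cop count])
        fix n assume "n \<in> A"
        then have "n > 0" "real n \<le> w + y" by (auto simp: A_def)
        then show "n > 0" "real n \<le> z powr K" using wy by simp_all
      qed
      also have "\<dots> \<le> C1 * Y * (2 * (real (totient q) / real q) * (c * ln N))"
      proof (intro mult_left_mono harmonic)
        have "ln (real q) \<le> ln (z powr K)" using qz q by (intro ln_mono) auto
        also have "\<dots> = K * ln z" using z by (simp add: ln_powr)
        also have "\<dots> \<le> K * ln N" using False z K by (intro mult_left_mono) auto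
        also have "\<dots> \<le> (K + 1 / \<kappa>) * ln N" using \<kappa> lnN by (intro mult_right_mono) auto
        finally show "ln (real q) \<le> (K + 1 / \<kappa>) * ln N" .
      qed (use z False C1 Y0 in auto)
      finally show ?thesis .
    qed
    also have "\<dots> = 4 * C1 * c * (y * real (totient q) * ln N / (real q)\<^sup>2)"
      by (simp add: Y_def power2_eq_square)
    finally show ?thesis by (simp add: A_def)
  qed
  have "4 * C1 * c > 0" using C1 c0 by simp
  then show thesis by (rule that) (rule bound)
qed

section \<open>Choice of \<open>z\<close> and of the constants\<close>

theorem theorem1p7:
  fixes \<delta> \<epsilon> \<kappa> :: real
  assumes "0 < \<delta>" and "\<delta> \<le> 1" and "0 < \<epsilon>" and "\<epsilon> < 1 / 8" and "0 < \<kappa>"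
  shows "\<exists>c0 C :: real. c0 > 0 \<and> C > 0 \<and>
    (\<forall>(N :: real) (q :: nat) (r :: int) (x :: real) (y :: real).
       N \<ge> 2 \<and> q > 0 \<and> N \<ge> real q powr \<kappa> \<and> coprime r (int q) \<and>
       x powr ((1 + 4 * \<epsilon> * \<delta>) / (1 + \<delta>)) \<le> y \<and> y \<le> x \<and>
       x \<ge> c0 * real q powr (1 + \<delta>) \<longrightarrow>
         (\<Sum>n | n > 0 \<and> x < real n \<and> real n \<le> x + y \<and> [int n = r] (mod int q). real (tau_le N n))
           \<le> C * (y * real (totient q) * ln N / (real q)\<^sup>2)
       \<and> (\<Sum>m | m > 0 \<and> real m \<le> x \<and> [int m = r] (mod int q). real (tau_le N m))
           \<le> C * (real (totient q) * x * ln N / (real q)\<^sup>2))"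
proof -
  \<comment> \<open>The exponent in the lower bound for \<open>y\<close> is
    \<open>1 / (1 + \<delta>) + \<eta>\<close>. As
    \<open>q \<le> x powr (1 / (1 + \<delta>))\<close>, there is room for
    \<open>z\<^sup>2 = x powr \<eta>\<close>.\<close>
  define \<eta> where "\<eta> = 4 * \<epsilon> * \<delta> / (1 + \<delta>)"
  have \<eta>0: "\<eta> > 0" using assms by (simp add: \<eta>_def)
  have "4 * \<epsilon> * \<delta> \<le> 1 * (1 + \<delta>)"
    using assms by (intro mult_mono) auto
  then have \<eta>1: "\<eta> \<le> 1" using assms by (simp add: \<eta>_def)
  \<comment> \<open>With \<open>z = x powr (\<eta> / 2)\<close> this makes \<open>z powr K\<close>
    equal to \<open>x\<^sup>2\<close>, which is at least \<open>2 * x\<close> and so covers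
    \<open>x + y\<close>.\<close>
  define K where "K = 4 / \<eta>"
  have K: "K \<ge> 1" using \<eta>0 \<eta>1 by (simp add: K_def)
  show ?thesis
  proof (rule sum_tau_le_progression_le[OF K assms(5)])
    fix C :: real
    assume C: "C > 0" and bound: "\<And>(z :: real) (N :: real) (q :: nat) (r :: int) (w :: real) (y :: real).
    z \<ge> 2 \<Longrightarrow> N \<ge> 2 \<Longrightarrow> q > 0 \<Longrightarrow> N \<ge> real q powr \<kappa> \<Longrightarrow> coprime r (int q) \<Longrightarrow> y \<ge> 0 \<Longrightarrow>
    z\<^sup>2 * real q \<le> y \<Longrightarrow> w + y \<le> z powr K \<Longrightarrow> real q \<le> z powr K \<Longrightarrow>
      (\<Sum>n | n > 0 \<and> w < real n \<and> real n \<le> w + y \<and> [int n = r] (mod int q). real (tau_le N n))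
        \<le> C * (y * real (totient q) * ln N / (real q)\<^sup>2)"
    \<comment> \<open>Since \<open>c0 powr (\<eta> / 2) = 2\<close>, the bound
      \<open>x \<ge> c0\<close> ensures \<open>z \<ge> 2\<close>.\<close>
    define c0 where "c0 = 2 powr (2 / \<eta>)"
    have c02: "c0 \<ge> 2"
    proof -
      have "2 powr 1 \<le> 2 powr (2 / \<eta>)" using \<eta>0 \<eta>1 by (intro powr_mono) (auto simp: field_simps)
      then show ?thesis by (simp add: c0_def)
    qed
    have main: "(\<Sum>n | n > 0 \<and> x < real n \<and> real n \<le> x + y \<and> [int n = r] (mod int q). real (tau_le N n))
             \<le> C * (y * real (totient q) * ln N / (real q)\<^sup>2)
         \<and> (\<Sum>m | m > 0 \<and> real m \<le> x \<and> [int m = r] (mod int q). real (tau_le N m))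
             \<le> C * (real (totient q) * x * ln N / (real q)\<^sup>2)"
      if N: "N \<ge> 2" and q: "q > 0" and Nq: "N \<ge> real q powr \<kappa>" and r: "coprime r (int q)"
        and xy: "x powr ((1 + 4 * \<epsilon> * \<delta>) / (1 + \<delta>)) \<le> y" "y \<le> x" and xq: "x \<ge> c0 * real q powr (1 + \<delta>)"
      for N :: real and q :: nat and r :: int and x y :: real
    proof -
      define z where "z = x powr (\<eta> / 2)"
      have q1: "real q powr (1 + \<delta>) \<ge> 1" using q assms by (intro ge_one_powr_ge_zero) auto
      have "c0 * 1 \<le> c0 * real q powr (1 + \<delta>)" using q1 c02 by (intro mult_left_mono) auto
      then have xc0: "x \<ge> c0" using xq by linarith
      then have x2: "x \<ge> 2" using c02 by linarith
      have "1 * real q powr (1 + \<delta>) \<le> c0 * real q powr (1 + \<delta>)" using c02 by (intro mult_right_mono) auto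
      then have xq1: "real q powr (1 + \<delta>) \<le> x" using xq by linarith
      have "c0 powr (\<eta> / 2) \<le> z" unfolding z_def using xc0 c02 \<eta>0 by (intro powr_mono2) auto
      then have z2: "z \<ge> 2" using \<eta>0 by (simp add: c0_def powr_powr)
      have zz: "z\<^sup>2 = x powr \<eta>" using x2 by (simp add: z_def power2_eq_square flip: powr_add)
      have zK: "z powr K = x\<^sup>2" using \<eta>0 x2 by (simp add: z_def K_def powr_powr powr_numeral)
      have "(real q powr (1 + \<delta>)) powr (1 / (1 + \<delta>)) \<le> x powr (1 / (1 + \<delta>))"
        using xq1 assms by (intro powr_mono2) auto
      then have qx: "real q \<le> x powr (1 / (1 + \<delta>))" using q assms by (simp add: powr_powr)
      have "z\<^sup>2 * real q \<le> x powr \<eta> * x powr (1 / (1 + \<delta>))"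
        unfolding zz using qx by (intro mult_left_mono) auto
      also have "\<dots> = x powr ((1 + 4 * \<epsilon> * \<delta>) / (1 + \<delta>))"
        by (simp add: \<eta>_def add_divide_distrib add.commute flip: powr_add)
      also have "\<dots> \<le> y" by (rule xy(1))
      finally have zqy: "z\<^sup>2 * real q \<le> y" .
      have y0: "y \<ge> 0" using xy(1) powr_ge_zero order_trans by blast
      have "x powr (1 / (1 + \<delta>)) \<le> x powr 1" using x2 assms by (intro powr_mono) auto
      then have qlex: "real q \<le> x" using qx x2 by simp
      have x22: "2 * x \<le> x\<^sup>2" using x2 by (simp add: power2_eq_square)
      have "(\<Sum>n | n > 0 \<and> x < real n \<and> real n \<le> x + y \<and> [int n = r] (mod int q). real (tau_le N n))
             \<le> C * (y * real (totient q) * ln N / (real q)\<^sup>2)"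
      proof (rule bound[OF z2 N q Nq r y0 zqy])
        show "x + y \<le> z powr K" "real q \<le> z powr K" unfolding zK using xy x22 qlex x2 by linarith+
      qed
      \<comment> \<open>The sum up to \<open>x\<close> has left endpoint 0 and length
        \<open>x\<close>; the length condition carries over because
        \<open>x \<ge> y\<close>.\<close>
      moreover have "(\<Sum>n | n > 0 \<and> 0 < real n \<and> real n \<le> 0 + x \<and> [int n = r] (mod int q). real (tau_le N n))
             \<le> C * (x * real (totient q) * ln N / (real q)\<^sup>2)"
      proof (rule bound[OF z2 N q Nq r])
        show "0 + x \<le> z powr K" "real q \<le> z powr K" unfolding zK using x22 qlex x2 by linarith+
      qed (use zqy xy x2 in linarith)+
      ultimately show ?thesis by (simp add: mult_ac)
    qed
    show ?thesis
      by (rule exI[of _ c0], rule exI[of _ C], intro conjI allI impI; (elim conjE)?)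
         (use C c02 main in \<open>simp_all only:\<close>)
  qed
qed

end
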